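(* A relaxed compensator $(H(\cdot),K(\cdot))\in\Lambda[0,T]\times\Lambda[0,T]$ for Problem (MF-LQ) exists if and only if the system of Riccati equations (argument $t$ suppressed) $$\left\{\begin{aligned}&\dot P+PA+A^\top P+C^\top PC+Q-\Gamma(P)^\top[D^\top PD+R]\Gamma(P)=0,\quad t\in[0,T],\\&P(T)=G,\\&D^\top PD+R\gg0\end{aligned}\right.$$ and $$\left\{\begin{aligned}&\dot{\widehat P}+\widehat P\widehat A+\widehat A^\top\widehat P+\widehat C^\top P\widehat C+\widehat Q-\widehat\Gamma(P,\widehat P)^\top[\widehat D^\top P\widehat D+\widehat R]\widehat\Gamma(P,\widehat P)=0,\quad t\in[0,T],\\&\widehat P(T)=\widehat G,\\&\widehat D^\top P\widehat D+\widehat R\gg0\end{aligned}\right.$$ admits a unique pair of solutions $(P(\cdot),\widehat P(\cdot))$ taking values in $\mathbb S^n\times\mathbb S^n$.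
   Context: Fix $T>0$ and positive integers $n,m$. $\mathbb S^n$ is the set of symmetric $n\times n$ real matrices. $L^\infty(0,T;\mathbb H)$ is the space of $\mathbb H$-valued (deterministic) continuous functions $\varphi$ with $\mathrm{esssup}_{t\in[0,T]}|\varphi(t)|<\infty$. The data of Problem (MF-LQ) (a mean-field linear-quadratic stochastic control problem with these coefficients) are: $A,\widetilde A,C,\widetilde C\in L^\infty(0,T;\mathbb R^{n\times n})$, $B,\widetilde B,D,\widetilde D\in L^\infty(0,T;\mathbb R^{n\times m})$, $Q,\widetilde Q\in L^\infty(0,T;\mathbb S^n)$, $S,\widetilde S\in L^\infty(0,T;\mathbb R^{n\times m})$, $R,\widetilde R\in L^\infty(0,T;\mathbb S^m)$, $G,\widetilde G\in\mathbb S^n$ (no definiteness is assumed). Write $\widehat F=F+\widetilde F$ for each $F\in\{A,B,C,D,Q,S,R,G\}$. For $P,\widehat P\in\mathbb S^n$, $$\begin{aligned}\Gamma(t,P)&=-[D^\top PD+R]^{-1}[PB+C^\top PD+S]^\top,\\ \widehat\Gamma(t,P,\widehat P)&=-[\widehat D^\top P\widehat D+\widehat R]^{-1}[\widehat P\widehat B+\widehat C^\top P\widehat D+\widehat S]^\top,\end{aligned}$$ with coefficients evaluated at $t$; $\Gamma(P)$, $\widehat\Gamma(P,\widehat P)$ denote $\Gamma(t,P(t))$, $\widehat\Gamma(t,P(t),\widehat P(t))$. Solutions of Riccati equations are continuously differentiable functions on $[0,T]$. For a symmetric-matrix-valued function $f$ on $[0,T]$, $f(\cdot)\ge0$ means $f(t)$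 is positive semidefinite for a.e. $t$, and $f(\cdot)\gg0$ means there is a constant $\delta>0$ with $f(\cdot)-\delta I\ge0$. Relaxed compensator: $\Lambda[0,T]$ is the set of functions $F:[0,T]\to\mathbb S^n$ of the form $F(t)=F(0)+\int_0^tf(s)ds$ with $f\in L^\infty(0,T;\mathbb S^n)$. For $(H,K)\in\Lambda[0,T]\times\Lambda[0,T]$ let $$\begin{aligned}&Q^{H,K}=\dot H+HA+A^\top H+C^\top HC+Q,&&\widehat Q^{H,K}=\dot K+K\widehat A+\widehat A^\top K+\widehat C^\top H\widehat C+\widehat Q,\\&S^{H,K}=HB+C^\top HD+S,&&\widehat S^{H,K}=K\widehat B+\widehat C^\top H\widehat D+\widehat S,\\&R^{H,K}=D^\top HD+R,&&\widehat R^{H,K}=\widehat D^\top H\widehat D+\widehat R,\\&G^{H,K}=G-H(T),&&\widehat G^{H,K}=\widehat G-K(T),\end{aligned}$$ and $\mathbf Q^{H,K}=\begin{pmatrix}Q^{H,K}&O\\O&\widehat Q^{H,K}\end{pmatrix}$, and likewise $\mathbf S^{H,K},\mathbf R^{H,K},\mathbf G^{H,K}$ (block diagonal with the unhatted and hatted entries). $(H,K)$ is called a relaxed compensator for Problem (MF-LQ) if $$\begin{pmatrix}\mathbf Q^{H,K}(\cdot)&\mathbf S^{H,K}(\cdot)\\\mathbf S^{H,K}(\cdot)^\top&\mathbf R^{H,K}(\cdot)\end{pmatrix}\ge0,\quad\mathbf R^{H,K}(\cdot)\gg0,\quad\mathbf G^{H,K}\ge0.$$ *)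

theory Defs
  imports "HOL-Analysis.Analysis" "HOL-Probability.Essential_Supremum"
begin

text \<open>
  The space of \<open>n \<times> m\<close> real matrices is \<^typ>\<open>real^'m^'n\<close>. Functions of time have type
  \<open>real \<Rightarrow> _\<close>; only their values on \<open>{0..T}\<close> are ever constrained or used.
\<close>

definition sym_matrices :: "(real^'n^'n) set" where
  "sym_matrices = {M. transpose M = M}"

definition psd :: "real^'n^'n \<Rightarrow> bool" where
  "psd M \<longleftrightarrow> M \<in> sym_matrices \<and> (\<forall>x. 0 \<le> x \<bullet> (M *v x))"

definition ae_nonneg :: "real \<Rightarrow> (real \<Rightarrow> real^'n^'n) \<Rightarrow> bool" where
  "ae_nonneg T f \<longleftrightarrow> (AE t in lebesgue_on {0..T}. psd (f t))"

definition uniformly_pos :: "real \<Rightarrow> (real \<Rightarrow> real^'n^'n) \<Rightarrow> bool" where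
  "uniformly_pos T f \<longleftrightarrow> (\<exists>\<delta>>0. ae_nonneg T (\<lambda>t. f t - \<delta> *\<^sub>R mat 1))"

text \<open>
  \<open>Linf T X\<close> is \<open>L\<^sup>\<infinity>(0,T;X)\<close> in the convention used here: its elements are \<^emph>\<open>continuous\<close>
  functions on \<open>[0,T]\<close>, not equivalence classes of measurable ones.
\<close>

definition Linf :: "real \<Rightarrow> (real^'m^'n) set \<Rightarrow> (real \<Rightarrow> real^'m^'n) set" where
  "Linf T X = {\<phi>. \<phi> \<in> {0..T} \<rightarrow> X \<and> continuous_on {0..T} \<phi> \<and>
     esssup (lebesgue_on {0..T}) (\<lambda>t. ereal (norm (\<phi> t))) < \<infinity>}"

text \<open>
  The derivative of a function on \<open>[0,T]\<close>, one-sided at the two end points. If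
  \<open>F t = F 0 + \<integral>\<^sub>0\<^sup>t f\<close> on \<open>[0,T]\<close> with \<open>f\<close> continuous, then \<open>ddt T F = f\<close> on \<open>[0,T]\<close>.
\<close>

definition ddt :: "real \<Rightarrow> (real \<Rightarrow> real^'m^'n) \<Rightarrow> real \<Rightarrow> real^'m^'n" where
  "ddt T F t = vector_derivative F (at t within {0..T})"

definition continuously_differentiable :: "real \<Rightarrow> (real \<Rightarrow> real^'m^'n) \<Rightarrow> bool" where
  "continuously_differentiable T F \<longleftrightarrow>
     (\<forall>t\<in>{0..T}. F differentiable (at t within {0..T})) \<and> continuous_on {0..T} (ddt T F)"

definition Lam :: "real \<Rightarrow> (real \<Rightarrow> real^'n^'n) set" where
  "Lam T = {F. F \<in> {0..T} \<rightarrow> sym_matrices \<and>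
     (\<exists>f \<in> Linf T sym_matrices. \<forall>t\<in>{0..T}. F t = F 0 + integral {0..t} f)}"

text \<open>
  The coefficients of Problem (MF-LQ). A field \<open>cX\<close> is the coefficient \<open>X\<close>, a field \<open>mX\<close> the
  mean-field coefficient \<open>X\<close> with a tilde.
\<close>

record ('n::finite, 'm::finite) mflq =
  cA :: "real \<Rightarrow> real^'n^'n"   mA :: "real \<Rightarrow> real^'n^'n"
  cB :: "real \<Rightarrow> real^'m^'n"   mB :: "real \<Rightarrow> real^'m^'n"
  cC :: "real \<Rightarrow> real^'n^'n"   mC :: "real \<Rightarrow> real^'n^'n"
  cD :: "real \<Rightarrow> real^'m^'n"   mD :: "real \<Rightarrow> real^'m^'n"
  cQ :: "real \<Rightarrow> real^'n^'n"   mQ :: "real \<Rightarrow> real^'n^'n"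
  cS :: "real \<Rightarrow> real^'m^'n"   mS :: "real \<Rightarrow> real^'m^'n"
  cR :: "real \<Rightarrow> real^'m^'m"   mR :: "real \<Rightarrow> real^'m^'m"
  cG :: "real^'n^'n"           mG :: "real^'n^'n"

definition mflq_data :: "real \<Rightarrow> ('n::finite, 'm::finite) mflq \<Rightarrow> bool" where
  "mflq_data T d \<longleftrightarrow>
     {cA d, mA d, cC d, mC d} \<subseteq> Linf T UNIV \<and>
     {cB d, mB d, cD d, mD d} \<subseteq> Linf T UNIV \<and>
     {cQ d, mQ d} \<subseteq> Linf T sym_matrices \<and>
     {cS d, mS d} \<subseteq> Linf T UNIV \<and>
     {cR d, mR d} \<subseteq> Linf T sym_matrices \<and>
     {cG d, mG d} \<subseteq> sym_matrices"

text \<open>\<open>hX\<close> is the sum of the two coefficients, written \<open>X\<close> with a hat.\<close>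

definition hA where "hA d t = cA d t + mA d t"
definition hB where "hB d t = cB d t + mB d t"
definition hC where "hC d t = cC d t + mC d t"
definition hD where "hD d t = cD d t + mD d t"
definition hQ where "hQ d t = cQ d t + mQ d t"
definition hS where "hS d t = cS d t + mS d t"
definition hR where "hR d t = cR d t + mR d t"
definition hG where "hG d = cG d + mG d"

definition Gam :: "('n::finite, 'm::finite) mflq \<Rightarrow> real \<Rightarrow> real^'n^'n \<Rightarrow> real^'n^'m" where
  "Gam d t P =
     - (matrix_inv (transpose (cD d t) ** P ** cD d t + cR d t)
        ** transpose (P ** cB d t + transpose (cC d t) ** P ** cD d t + cS d t))"

definition hGam ::
  "('n::finite, 'm::finite) mflq \<Rightarrow> real \<Rightarrow> real^'n^'n \<Rightarrow> real^'n^'n \<Rightarrow> real^'n^'m" where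
  "hGam d t P Ph =
     - (matrix_inv (transpose (hD d t) ** P ** hD d t + hR d t)
        ** transpose (Ph ** hB d t + transpose (hC d t) ** P ** hD d t + hS d t))"

definition riccati_system ::
  "real \<Rightarrow> ('n::finite, 'm::finite) mflq \<Rightarrow> (real \<Rightarrow> real^'n^'n) \<Rightarrow> (real \<Rightarrow> real^'n^'n) \<Rightarrow> bool" where
  "riccati_system T d P Ph \<longleftrightarrow>
     P \<in> {0..T} \<rightarrow> sym_matrices \<and> Ph \<in> {0..T} \<rightarrow> sym_matrices \<and>
     continuously_differentiable T P \<and> continuously_differentiable T Ph \<and>
     (\<forall>t\<in>{0..T}.
        ddt T P t + P t ** cA d t + transpose (cA d t) ** P t
        + transpose (cC d t) ** P t ** cC d t + cQ d t
        - transpose (Gam d t (P t)) ** (transpose (cD d t) ** P t ** cD d t + cR d t)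
            ** Gam d t (P t) = 0) \<and>
     P T = cG d \<and>
     uniformly_pos T (\<lambda>t. transpose (cD d t) ** P t ** cD d t + cR d t) \<and>
     (\<forall>t\<in>{0..T}.
        ddt T Ph t + Ph t ** hA d t + transpose (hA d t) ** Ph t
        + transpose (hC d t) ** P t ** hC d t + hQ d t
        - transpose (hGam d t (P t) (Ph t)) ** (transpose (hD d t) ** P t ** hD d t + hR d t)
            ** hGam d t (P t) (Ph t) = 0) \<and>
     Ph T = hG d \<and>
     uniformly_pos T (\<lambda>t. transpose (hD d t) ** P t ** hD d t + hR d t)"

definition block_mat ::
  "real^'q^'p \<Rightarrow> real^'s^'p \<Rightarrow> real^'q^'r \<Rightarrow> real^'s^'r \<Rightarrow> real^('q + 's)^('p + 'r)" where
  "block_mat M11 M12 M21 M22 = (\<chi> i j. case i of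
       Inl i' \<Rightarrow> (case j of Inl j' \<Rightarrow> M11 $ i' $ j' | Inr j' \<Rightarrow> M12 $ i' $ j')
     | Inr i' \<Rightarrow> (case j of Inl j' \<Rightarrow> M21 $ i' $ j' | Inr j' \<Rightarrow> M22 $ i' $ j'))"

definition block_diag :: "real^'q^'p \<Rightarrow> real^'s^'r \<Rightarrow> real^('q + 's)^('p + 'r)" where
  "block_diag X Y = block_mat X 0 0 Y"

text \<open>\<open>bX\<close> is the boldface \<open>X\<^sup>H\<^sup>,\<^sup>K\<close>; \<open>ddt T H\<close> exists on all of \<open>[0,T]\<close> because \<open>H \<in> Lam T\<close>.\<close>

definition bQ where
  "bQ T d H K t = block_diag
     (ddt T H t + H t ** cA d t + transpose (cA d t) ** H t
        + transpose (cC d t) ** H t ** cC d t + cQ d t)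
     (ddt T K t + K t ** hA d t + transpose (hA d t) ** K t
        + transpose (hC d t) ** H t ** hC d t + hQ d t)"

definition bS where
  "bS d H K t = block_diag
     (H t ** cB d t + transpose (cC d t) ** H t ** cD d t + cS d t)
     (K t ** hB d t + transpose (hC d t) ** H t ** hD d t + hS d t)"

definition bR where
  "bR d H t = block_diag
     (transpose (cD d t) ** H t ** cD d t + cR d t)
     (transpose (hD d t) ** H t ** hD d t + hR d t)"

definition bG where
  "bG T d H K = block_diag (cG d - H T) (hG d - K T)"

definition relaxed_compensator ::
  "real \<Rightarrow> ('n::finite, 'm::finite) mflq \<Rightarrow> (real \<Rightarrow> real^'n^'n) \<Rightarrow> (real \<Rightarrow> real^'n^'n) \<Rightarrow> bool" where
  "relaxed_compensator T d H K \<longleftrightarrow>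
     H \<in> Lam T \<and> K \<in> Lam T \<and>
     ae_nonneg T (\<lambda>t. block_mat (bQ T d H K t) (bS d H K t) (transpose (bS d H K t)) (bR d H t)) \<and>
     uniformly_pos T (bR d H) \<and>
     psd (bG T d H K)"

end

theory Submission
  imports Defs
begin

text \<open>
  Both equations of the system are Riccati equations of one and the same kind. The first is the
  standard stochastic Riccati equation with coefficients \<open>A, B, C, D, Q, S, R\<close>. Once \<open>P\<close> is known,
  the second is such an equation for \<open>P\<close>-hat with drift coefficients \<open>A\<close>-hat, \<open>B\<close>-hat, no diffusion
  coefficients, and the terms in \<open>P\<close> absorbed into the weights. Everything is
  therefore proved once, in the locale \<open>riccati_equation\<close>, and used twice.

  The key to the equation is algebraic. Write \<open>M(X)\<close> for the symmetric block matrix with blocks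
  \<open>lyap X\<close>, \<open>cross X\<close> and \<open>weight X\<close>, which is affine in \<open>X\<close>. The nonlinearity \<open>ric X\<close> is its Schur
  complement, and it equals the value of the bilinear expression \<open>[I; G1]\<^sup>T M(X) [I; G2]\<close> whenever one
  of the two gains \<open>G1\<close>, \<open>G2\<close> is the optimal feedback of \<open>X\<close>, whatever the other one is
  (\<open>ric_eq_cost_form\<close>). Three facts follow. Choosing the feedback of \<open>X\<close> on the left and that of \<open>Y\<close>
  on the right turns \<open>ric X - ric Y\<close> into an expression linear in \<open>X - Y\<close> (\<open>ric_diff\<close>), so the
  difference of two solutions solves a linear homogeneous equation and vanishes: solutions are
  unique (\<open>solution_unique\<close>). The same identity makes \<open>ric\<close> Lipschitz where the feedback is bounded.
  Finally, choosing the same feedback on both sides shows that for nonnegative data the vector field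
  points into the cone of positive semidefinite matrices.

  Existence for nonnegative data (\<open>solution_exists_psd\<close>) solves the equation with its argument
  projected to a bounded part of the cone; that equation is globally Lipschitz. Its solution stays in
  the cone, because the squared distance to the cone cannot grow, and the affine part of \<open>ric\<close>
  bounds its trace independently of the truncation, so that the truncation was not active. For
  general data, a compensator \<open>H\<close> turns the equation for \<open>P\<close> into one for \<open>P - H\<close> with nonnegative
  data (\<open>solution_exists_above\<close>); hence \<open>P\<close> exists and \<open>P - H\<close> is positive semidefinite. This
  inequality is what keeps \<open>K\<close> a compensator for the second equation when \<open>H\<close> is replaced by \<open>P\<close>
  in its weights, and the same theorem then gives \<open>P\<close>-hat.

  Conversely, a pair of solutions is itself a relaxed compensator: the terminal matrices vanish, and
  each diagonal block equals \<open>[G, - I]\<^sup>T W [G, - I]\<close> with \<open>W\<close> the positive weight and \<open>G\<close> the feedback.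
\<close>

section \<open>Backward differential equations\<close>

lemma within_derivative_nonneg_imp_le:
  fixes f :: "real \<Rightarrow> real"
  assumes "a \<le> b"
    and der: "\<And>t. t \<in> {a..b} \<Longrightarrow> (f has_vector_derivative f' t) (at t within {a..b})"
    and nonneg: "\<And>t. t \<in> {a..b} \<Longrightarrow> 0 \<le> f' t"
  shows "f a \<le> f b"
proof (rule DERIV_nonneg_imp_increasing_open[OF \<open>a \<le> b\<close>])
  fix x assume "a < x" "x < b"
  then show "\<exists>y. DERIV f x :> y \<and> y \<ge> 0"
    using der[of x] nonneg[of x]
    by (auto simp: at_within_Icc_at has_real_derivative_iff_has_vector_derivative)
next
  show "continuous_on {a..b} f"
    by (rule continuous_on_vector_derivative[OF der])
qed

text \<open>
  The weight \<open>exp (2 * C * t)\<close> compensates the worst admissible decrease of the squared norm, so the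
  weighted squared norm is nondecreasing, and it vanishes at \<open>T\<close>.
\<close>

lemma backward_gronwall_zero:
  fixes y :: "real \<Rightarrow> 'a::euclidean_space"
  assumes der: "\<And>t. t \<in> {0..T} \<Longrightarrow> (y has_vector_derivative y' t) (at t within {0..T})"
    and bound: "\<And>t. t \<in> {0..T} \<Longrightarrow> norm (y' t) \<le> C * norm (y t)"
    and "y T = 0" and t: "t \<in> {0..T}"
  shows "y t = 0"
proof -
  define g where "g = (\<lambda>t. exp (2 * C * t) * (y t \<bullet> y t))"
  have "g t \<le> g T"
  proof (rule within_derivative_nonneg_imp_le[where f = g])
    fix s assume s: "s \<in> {t..T}"
    have d: "(y has_vector_derivative y' s) (at s within {t..T})"
      using der[of s] t s by (auto intro: has_vector_derivative_within_subset)
    have e: "((\<lambda>t. exp (2 * C * t)) has_vector_derivative 2 * C * exp (2 * C * s)) (at s within {t..T})"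
      by (auto intro!: derivative_eq_intros simp: has_real_derivative_iff_has_vector_derivative[symmetric])
    have "((\<lambda>t. y t \<bullet> y t) has_vector_derivative (y s \<bullet> y' s + y' s \<bullet> y s)) (at s within {t..T})"
      by (rule bounded_bilinear.has_vector_derivative[OF bounded_bilinear_inner d d])
    from has_vector_derivative_mult[OF e this]
    show "(g has_vector_derivative exp (2 * C * s) * (2 * C * (y s \<bullet> y s) + 2 * (y s \<bullet> y' s)))
        (at s within {t..T})"
      unfolding g_def by (rule has_vector_derivative_eq_rhs) (simp add: algebra_simps inner_commute)
    have "- (y s \<bullet> y' s) \<le> norm (y s) * norm (y' s)"
      using Cauchy_Schwarz_ineq2[of "y s" "y' s"] by linarith
    also have "\<dots> \<le> norm (y s) * (C * norm (y s))"
      using bound[of s] s t by (intro mult_left_mono) auto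
    also have "\<dots> = C * (y s \<bullet> y s)"
      by (simp add: power2_norm_eq_inner[symmetric] power2_eq_square)
    finally show "0 \<le> exp (2 * C * s) * (2 * C * (y s \<bullet> y s) + 2 * (y s \<bullet> y' s))"
      by simp
  qed (use t in auto)
  then have "exp (2 * C * t) * (y t \<bullet> y t) \<le> 0"
    using \<open>y T = 0\<close> by (simp add: g_def)
  then have "y t \<bullet> y t \<le> 0"
    by (simp add: mult_le_0_iff)
  then show ?thesis
    by (metis inner_eq_zero_iff inner_ge_zero order_antisym)
qed

text \<open>
  The projection itself need not be differentiable, but the minimising property makes its variation
  a second-order contribution to the squared distance.
\<close>

lemma has_derivative_dist_closest_point_squared:
  fixes S :: "'a::euclidean_space set"
  assumes S: "convex S" "closed S" "S \<noteq> {}"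
  shows "((\<lambda>x. (norm (x - closest_point S x))\<^sup>2) has_derivative
      (\<lambda>h. 2 * ((x - closest_point S x) \<bullet> h))) (at x)"
proof -
  let ?p = "closest_point S"
  let ?g = "\<lambda>x. (norm (x - ?p x))\<^sup>2"
  have p: "?p z \<in> S" for z
    using closest_point_in_set[OF S(2,3)] .
  have near: "?g z \<le> (norm (z - ?p w))\<^sup>2" for z w
    using closest_point_le[OF S(2) p, of z w] by (simp add: dist_norm)
  \<comment> \<open>The upper estimate compares \<open>x + h\<close> with the old projection, the lower one \<open>x\<close> with the new one.\<close>
  have bound: "\<bar>?g (x + h) - ?g x - 2 * ((x - ?p x) \<bullet> h)\<bar> \<le> 5 * (norm h)\<^sup>2" for h
  proof -
    have "?g (x + h) \<le> (norm (x + h - ?p x))\<^sup>2"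
      by (rule near)
    also have "\<dots> = ?g x + 2 * ((x - ?p x) \<bullet> h) + (norm h)\<^sup>2"
      by (simp only: power2_norm_eq_inner) (simp add: algebra_simps inner_commute)
    finally have up: "?g (x + h) - ?g x - 2 * ((x - ?p x) \<bullet> h) \<le> (norm h)\<^sup>2"
      by simp
    have "?g x \<le> (norm (x - ?p (x + h)))\<^sup>2"
      by (rule near)
    also have "\<dots> = ?g (x + h) - 2 * ((x + h - ?p (x + h)) \<bullet> h) + (norm h)\<^sup>2"
      by (simp only: power2_norm_eq_inner) (simp add: algebra_simps inner_commute)
    finally have *: "?g x \<le> ?g (x + h) - 2 * ((x + h - ?p (x + h)) \<bullet> h) + (norm h)\<^sup>2" .
    have "norm (?p (x + h) - ?p x) \<le> norm h"
      using closest_point_lipschitz[OF S, of "x + h" x] by (simp add: dist_norm)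
    then have "(?p (x + h) - ?p x) \<bullet> h \<le> norm h * norm h"
      by (meson mult_right_mono norm_cauchy_schwarz norm_ge_zero order_trans)
    then have "(x + h - ?p (x + h)) \<bullet> h \<ge> (x - ?p x) \<bullet> h - (norm h)\<^sup>2"
      by (simp add: power2_eq_square inner_diff_left inner_add_left)
        (smt (verit) inner_ge_zero)
    with * have lo: "?g (x + h) - ?g x - 2 * ((x - ?p x) \<bullet> h) \<ge> - 3 * (norm h)\<^sup>2"
      by simp
    show ?thesis
      using up lo zero_le_power2[of "norm h"] by linarith
  qed
  show ?thesis
    unfolding has_derivative_at
  proof
    show "bounded_linear (\<lambda>h. 2 * ((x - ?p x) \<bullet> h))"
      by (intro bounded_linear_const_mult bounded_linear_inner_right)
    have "((\<lambda>h. 5 * norm h) \<longlongrightarrow> 0) (at (0::'a))"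
      by (rule tendsto_eq_intros refl)+ simp
    then show "(\<lambda>h. norm (?g (x + h) - ?g x - 2 * ((x - ?p x) \<bullet> h)) / norm h) \<midarrow>0\<rightarrow> 0"
    proof (rule Lim_null_comparison[rotated])
      have "norm (norm (?g (x + h) - ?g x - 2 * ((x - ?p x) \<bullet> h)) / norm h) \<le> 5 * norm h" if "h \<noteq> 0" for h
        using bound[of h] that by (simp add: divide_le_eq power2_eq_square mult.assoc)
      then show "\<forall>\<^sub>F h in at 0. norm (norm (?g (x + h) - ?g x - 2 * ((x - ?p x) \<bullet> h)) / norm h) \<le> 5 * norm h"
        by (simp add: eventually_at_filter)
    qed
  qed
qed

text \<open>
  A version of Nagumo's theorem for solutions of \<open>y' = - v\<close> run backwards from \<open>T\<close>: the condition
  \<open>inward\<close> says that the squared distance to \<open>S\<close> is nondecreasing in \<open>t\<close>, and at \<open>T\<close> it is zero.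
\<close>

lemma backward_invariance_closed_convex:
  fixes y :: "real \<Rightarrow> 'a::euclidean_space"
  assumes S: "convex S" "closed S" "S \<noteq> {}"
    and der: "\<And>t. t \<in> {0..T} \<Longrightarrow> (y has_vector_derivative - v t) (at t within {0..T})"
    and inward: "\<And>t. t \<in> {0..T} \<Longrightarrow> (y t - closest_point S (y t)) \<bullet> v t \<le> 0"
    and "y T \<in> S" and t: "t \<in> {0..T}"
  shows "y t \<in> S"
proof -
  let ?p = "closest_point S"
  define g where "g = (\<lambda>t. (norm (y t - ?p (y t)))\<^sup>2)"
  have "g t \<le> g T"
  proof (rule within_derivative_nonneg_imp_le[where f = g])
    fix s assume s: "s \<in> {t..T}"
    have d: "(y has_vector_derivative - v s) (at s within {t..T})"
      using der[of s] t s by (auto intro: has_vector_derivative_within_subset)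
    show "(g has_vector_derivative 2 * ((y s - ?p (y s)) \<bullet> - v s)) (at s within {t..T})"
      using has_derivative_compose[OF d[unfolded has_vector_derivative_def]
          has_derivative_dist_closest_point_squared[OF S, of "y s"]]
      by (simp add: g_def has_vector_derivative_def mult.left_commute)
    show "0 \<le> 2 * ((y s - ?p (y s)) \<bullet> - v s)"
      using inward[of s] s t by simp
  qed (use t in auto)
  also have "g T = 0"
    using \<open>y T \<in> S\<close> by (simp add: g_def closest_point_self)
  finally have "y t = ?p (y t)"
    by (simp add: g_def)
  then show ?thesis
    using closest_point_in_set[OF S(2,3), of "y t"] by simp
qed

text \<open>
  The Lipschitz constant is global, so one fixed point argument covers the whole interval. Continuity
  of \<open>f\<close> is asked for along curves, because that is the form in which it is used under the integral.
\<close>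

lemma backward_picard_lindelof:
  fixes f :: "real \<Rightarrow> 'a::euclidean_space \<Rightarrow> 'a"
  assumes T: "0 < T"
    and cont: "\<And>y. continuous_on {0..T} y \<Longrightarrow> continuous_on {0..T} (\<lambda>t. f t (y t))"
    and lip: "\<And>t x z. t \<in> {0..T} \<Longrightarrow> norm (f t x - f t z) \<le> L * norm (x - z)"
  obtains y where "y T = G"
    and "\<And>t. t \<in> {0..T} \<Longrightarrow> (y has_vector_derivative - f t (y t)) (at t within {0..T})"
proof -
  \<comment> \<open>The unknown is rescaled by \<open>w\<close>, so that the integral operator contracts with factor
    \<open>\<bar>L\<bar> / l < 1 / 2\<close> however long the interval is. Precomposition with \<open>c\<close> extends functions on
    \<open>{0..T}\<close> to the whole line by constants, as the complete space consists of functions on a type.\<close>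
  define l where "l = 2 * \<bar>L\<bar> + 1"
  define w where "w = (\<lambda>t. exp (l * (T - t)))"
  define I where "I = (\<lambda>u t. G + integral {t..T} (\<lambda>s. f s (w s *\<^sub>R u s)))"
  define c where "c = (\<lambda>t. clamp 0 T (t::real))"
  define \<Phi> where "\<Phi> = (\<lambda>u. Bcontfun (\<lambda>t. (1 / w (c t)) *\<^sub>R I (apply_bcontfun u) (c t)))"
  have l: "l > 0" by (simp add: l_def)
  have w: "w t > 0" for t by (simp add: w_def)
  have cT: "c t \<in> {0..T}" for t
    using clamp_in_interval[of "0::real" T t] T by (simp add: c_def)
  have c_id: "c t = t" if "t \<in> {0..T}" for t
    using that clamp_cancel_cbox[of t 0 T] by (simp add: c_def)
  have fc: "continuous_on {0..T} (\<lambda>s. f s (w s *\<^sub>R apply_bcontfun u s))" for u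
    by (intro cont continuous_intros) (auto simp: w_def intro!: continuous_intros)
  have fi: "(\<lambda>s. f s (w s *\<^sub>R apply_bcontfun u s)) integrable_on {t..T}" if "t \<in> {0..T}" for u t
    by (rule integrable_continuous_real, rule continuous_on_subset[OF fc]) (use that in auto)
  have Ider: "(I (apply_bcontfun u) has_vector_derivative - f t (w t *\<^sub>R apply_bcontfun u t))
      (at t within {0..T})" if "t \<in> {0..T}" for u t
  proof -
    let ?h = "\<lambda>s. f s (w s *\<^sub>R apply_bcontfun u s)"
    have d: "((\<lambda>t. G + (integral {0..T} ?h - integral {0..t} ?h)) has_vector_derivative 0 + (0 - ?h t)) (at t within {0..T})"
      by (rule has_vector_derivative_add[OF has_vector_derivative_const
            has_vector_derivative_diff[OF has_vector_derivative_const
              integral_has_vector_derivative[OF fc that]]])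
    have eq: "I (apply_bcontfun u) x' = G + (integral {0..T} ?h - integral {0..x'} ?h)" if "x' \<in> {0..T}" for x'
    proof -
      have "integral {0..x'} ?h + integral {x'..T} ?h = integral {0..T} ?h"
        using that by (intro Henstock_Kurzweil_Integration.integral_combine integrable_continuous_real fc) auto
      then show ?thesis
        unfolding I_def by (metis add_diff_cancel_left')
    qed
    show ?thesis
      using has_vector_derivative_transform[OF that eq d] by simp
  qed
  have Icont: "continuous_on {0..T} (I (apply_bcontfun u))" for u
    by (rule continuous_on_vector_derivative[OF Ider])
  have app: "apply_bcontfun (\<Phi> u) t = (1 / w (c t)) *\<^sub>R I (apply_bcontfun u) (c t)" for u t
  proof -
    let ?k = "\<lambda>t. (1 / w t) *\<^sub>R I (apply_bcontfun u) t"
    have "continuous_on (cbox 0 T) (\<lambda>t. 1 / w t)"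
      unfolding w_def by (intro continuous_intros) simp
    moreover have "continuous_on (cbox 0 T) (I (apply_bcontfun u))"
      using Icont[of u] by simp
    ultimately have k: "continuous_on (cbox 0 T) ?k"
      by (rule continuous_on_scaleR)
    have "bounded (?k ` cbox 0 T)"
      by (rule compact_imp_bounded[OF compact_continuous_image[OF k compact_cbox]])
    then have "(\<lambda>t. ?k (c t)) \<in> bcontfun"
      unfolding bcontfun_def c_def using clamp_bounded clamp_continuous_on[OF k] by blast
    then show ?thesis
      unfolding \<Phi>_def by (rule Bcontfun_inverse[THEN fun_cong])
  qed
  have contr: "dist (\<Phi> u) (\<Phi> v) \<le> 1/2 * dist u v" for u v
  proof (rule dist_bound)
    fix t0
    define t where "t = c t0"
    have t: "t \<in> {0..T}" unfolding t_def by (rule cT)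
    let ?D = "\<lambda>s. f s (w s *\<^sub>R apply_bcontfun u s) - f s (w s *\<^sub>R apply_bcontfun v s)"
    have hint: "((\<lambda>s. (\<bar>L\<bar> * dist u v) * w s) has_integral (\<bar>L\<bar> * dist u v) * ((w t - 1) / l)) {t..T}"
    proof -
      have "((\<lambda>s. w s) has_integral (- (w T / l) - - (w t / l))) {t..T}"
        using t l unfolding w_def
        by (intro fundamental_theorem_of_calculus)
          (auto intro!: derivative_eq_intros simp: has_real_derivative_iff_has_vector_derivative[symmetric])
      then have "((\<lambda>s. w s) has_integral (w t - 1) / l) {t..T}"
        by (simp add: w_def diff_divide_distrib)
      then show ?thesis
        by (rule has_integral_mult_right)
    qed
    have pt: "norm (?D s) \<le> (\<bar>L\<bar> * dist u v) * w s" if "s \<in> {t..T}" for s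
    proof -
      have "norm (?D s) \<le> L * norm (w s *\<^sub>R apply_bcontfun u s - w s *\<^sub>R apply_bcontfun v s)"
        using that t by (intro lip) auto
      also have "\<dots> = L * (w s * dist (apply_bcontfun u s) (apply_bcontfun v s))"
        using w[of s] by (simp add: real_vector.scale_right_diff_distrib[symmetric] dist_norm del: real_vector.scale_right_diff_distrib)
      also have "\<dots> \<le> \<bar>L\<bar> * (w s * dist u v)"
        using w[of s] by (intro mult_mono mult_left_mono dist_bounded) auto
      finally show ?thesis by (simp only: mult_ac)
    qed
    have "norm (I (apply_bcontfun u) t - I (apply_bcontfun v) t) = norm (integral {t..T} ?D)"
      using fi[OF t] by (simp add: I_def integral_diff)
    also have "\<dots> \<le> integral {t..T} (\<lambda>s. (\<bar>L\<bar> * dist u v) * w s)"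
      by (rule integral_norm_bound_integral[OF integrable_diff[OF fi[OF t] fi[OF t]] has_integral_integrable[OF hint] pt])
    also have "\<dots> = (\<bar>L\<bar> * dist u v) * ((w t - 1) / l)"
      using hint by (rule integral_unique)
    also have "\<dots> \<le> (l / 2 * dist u v) * (w t / l)"
    proof (rule mult_mono)
      show "\<bar>L\<bar> * dist u v \<le> l / 2 * dist u v"
        by (intro mult_right_mono) (auto simp: l_def)
      show "(w t - 1) / l \<le> w t / l"
        using l by (intro divide_right_mono) auto
      have "w t \<ge> 1"
        using l t by (simp add: w_def)
      then show "0 \<le> (w t - 1) / l"
        using l by simp
      show "0 \<le> l / 2 * dist u v"
        using l by simp
    qed
    also have "\<dots> = w t * (1/2 * dist u v)"
      using l by simp
    finally have "norm (I (apply_bcontfun u) t - I (apply_bcontfun v) t) / w t \<le> 1/2 * dist u v"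
      by (simp only: pos_divide_le_eq[OF w] mult.commute)
    then show "dist (apply_bcontfun (\<Phi> u) t0) (apply_bcontfun (\<Phi> v) t0) \<le> 1/2 * dist u v"
    proof -
      assume *: "norm (I (apply_bcontfun u) t - I (apply_bcontfun v) t) / w t \<le> 1/2 * dist u v"
      have "dist (apply_bcontfun (\<Phi> u) t0) (apply_bcontfun (\<Phi> v) t0)
          = norm ((1 / w t) *\<^sub>R (I (apply_bcontfun u) t - I (apply_bcontfun v) t))"
        unfolding app t_def[symmetric] dist_norm by (simp only: scaleR_diff_right)
      also have "\<dots> = norm (I (apply_bcontfun u) t - I (apply_bcontfun v) t) / w t"
        using w[of t] by simp
      finally show ?thesis
        using * by simp
    qed
  qed
  obtain u where u: "\<Phi> u = u"
  proof -
    have "\<exists>!u. \<Phi> u = u"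
      by (rule banach_fix_type[of "1/2"]) (simp, simp, intro allI contr)
    then show ?thesis
      using that by blast
  qed
  have fixed: "I (apply_bcontfun u) t = w t *\<^sub>R apply_bcontfun u t" if "t \<in> {0..T}" for t
  proof -
    have "apply_bcontfun u t = (1 / w t) *\<^sub>R I (apply_bcontfun u) t"
      using app[of u t] unfolding u c_id[OF that] .
    then show ?thesis
      using w[of t] by simp
  qed
  show ?thesis
  proof
    show "I (apply_bcontfun u) T = G"
      by (simp add: I_def)
    show "(I (apply_bcontfun u) has_vector_derivative - f t (I (apply_bcontfun u) t)) (at t within {0..T})"
      if "t \<in> {0..T}" for t
      unfolding fixed[OF that] by (rule Ider[OF that])
  qed
qed

section \<open>Matrices and the cone of positive semidefinite matrices\<close>

lemma bounded_bilinear_matrix_matrix_mult: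
  "bounded_bilinear ((**) :: real^'n^'m \<Rightarrow> real^'p^'n \<Rightarrow> real^'p^'m)"
proof -
  have "bilinear ((**) :: real^'n^'m \<Rightarrow> real^'p^'n \<Rightarrow> real^'p^'m)"
    unfolding bilinear_def
    by (auto intro!: linearI simp: matrix_matrix_mult_def vec_eq_iff algebra_simps
        sum.distrib sum_distrib_left)
  then show ?thesis
    by (simp add: bilinear_conv_bounded_bilinear)
qed

lemma bounded_linear_transpose: "bounded_linear (transpose :: real^'n^'m \<Rightarrow> real^'m^'n)"
  by (rule linear_conv_bounded_linear[THEN iffD1])
    (auto intro!: linearI simp: transpose_def vec_eq_iff)

lemmas continuous_on_matrix_mult [continuous_intros] =
  bounded_bilinear.continuous_on[OF bounded_bilinear_matrix_matrix_mult]

lemmas continuous_on_transpose [continuous_intros] =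
  bounded_linear.continuous_on[OF bounded_linear_transpose]

text \<open>
  Rewrite rules that expand matrix expressions into sums of right-nested products with transposes
  pushed to the atoms. The positions are relied on below: 1--10 expand products without moving
  transposes, 11--15 are the linearity rules for transposes.
\<close>

lemmas matrix_algebra =
  bounded_bilinear.add_left[OF bounded_bilinear_matrix_matrix_mult]
  bounded_bilinear.add_right[OF bounded_bilinear_matrix_matrix_mult]
  bounded_bilinear.diff_left[OF bounded_bilinear_matrix_matrix_mult]
  bounded_bilinear.diff_right[OF bounded_bilinear_matrix_matrix_mult]
  bounded_bilinear.minus_left[OF bounded_bilinear_matrix_matrix_mult]
  bounded_bilinear.minus_right[OF bounded_bilinear_matrix_matrix_mult]
  bounded_bilinear.scaleR_left[OF bounded_bilinear_matrix_matrix_mult]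
  bounded_bilinear.scaleR_right[OF bounded_bilinear_matrix_matrix_mult]
  bounded_bilinear.zero_left[OF bounded_bilinear_matrix_matrix_mult]
  bounded_bilinear.zero_right[OF bounded_bilinear_matrix_matrix_mult]
  linear_add[OF bounded_linear.linear[OF bounded_linear_transpose]]
  linear_diff[OF bounded_linear.linear[OF bounded_linear_transpose]]
  linear_neg[OF bounded_linear.linear[OF bounded_linear_transpose]]
  linear_cmul[OF bounded_linear.linear[OF bounded_linear_transpose]]
  linear_0[OF bounded_linear.linear[OF bounded_linear_transpose]]
  matrix_transpose_mul matrix_mul_assoc[symmetric]

lemma inner_transpose_matrix_vector:
  fixes M :: "real^'n^'m"
  shows "x \<bullet> (transpose M *v y) = (M *v x) \<bullet> y"
  by (metis dot_lmul_matrix inner_commute transpose_matrix_vector)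

lemma bilinear_form_add:
  fixes M N :: "real^'l^'k"
  shows "z \<bullet> ((M + N) *v y) = z \<bullet> (M *v y) + z \<bullet> (N *v y)"
  by (simp add: matrix_vector_mult_add_rdistrib inner_add_right)

lemma norm_matrix_matrix_mult_le:
  obtains K where "0 < K"
    "\<And>(M :: real^'n^'m) (N :: real^'p^'n). norm (M ** N) \<le> norm M * norm N * K"
  using bounded_bilinear.pos_bounded[OF bounded_bilinear_matrix_matrix_mult] by blast

text \<open>
  Both the linear part of the Riccati operator and the increments of its nonlinearity have this shape,
  with bounded coefficients \<open>e1\<close> to \<open>e4\<close>. One constant serves all of them.
\<close>

lemma two_sided_mult_bound:
  obtains C where "0 \<le> C"
    "\<And>(X :: real^'n^'n) e1 e2 e3 e4. \<lbrakk>norm e1 \<le> B; norm e2 \<le> B; norm e3 \<le> B; norm e4 \<le> B\<rbrakk> \<Longrightarrow>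
      norm (X ** e1 + e2 ** X + e3 ** X ** e4) \<le> C * norm X"
proof (cases "0 \<le> B")
  case True
  obtain K where K: "0 < K" "\<And>(M :: real^'n^'n) (N :: real^'n^'n). norm (M ** N) \<le> norm M * norm N * K"
    using norm_matrix_matrix_mult_le by blast
  show ?thesis
  proof
    show "0 \<le> B * K + B * K + B * K * (B * K)"
      using True K(1) by simp
    fix X e1 e2 e3 e4 :: "real^'n^'n"
    assume e: "norm e1 \<le> B" "norm e2 \<le> B" "norm e3 \<le> B" "norm e4 \<le> B"
    have l: "norm (M ** e) \<le> B * K * norm M" if "norm e \<le> B" for M e :: "real^'n^'n"
    proof -
      have "norm (M ** e) \<le> norm M * norm e * K" by (rule K)
      also have "\<dots> \<le> norm M * B * K"
        using that K(1) by (intro mult_right_mono mult_left_mono) auto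
      finally show ?thesis by (simp only: mult_ac)
    qed
    have r: "norm (e ** M) \<le> B * K * norm M" if "norm e \<le> B" for M e :: "real^'n^'n"
    proof -
      have "norm (e ** M) \<le> norm e * norm M * K" by (rule K)
      also have "\<dots> \<le> B * norm M * K"
        using that K(1) by (intro mult_right_mono) auto
      finally show ?thesis by (simp only: mult_ac)
    qed
    have "norm (e3 ** X ** e4) \<le> B * K * norm (e3 ** X)"
      by (rule l[OF e(4)])
    also have "\<dots> \<le> B * K * (B * K * norm X)"
      using r[OF e(3)] True K(1) by (intro mult_left_mono) auto
    finally have "norm (e3 ** X ** e4) \<le> B * K * (B * K) * norm X"
      by (simp only: mult.assoc)
    then show "norm (X ** e1 + e2 ** X + e3 ** X ** e4) \<le> (B * K + B * K + B * K * (B * K)) * norm X"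
      using l[OF e(1), of X] r[OF e(2), of X]
        norm_triangle_ineq[of "X ** e1 + e2 ** X" "e3 ** X ** e4"]
        norm_triangle_ineq[of "X ** e1" "e2 ** X"]
      by (simp only: distrib_right)
  qed
next
  case False
  then show ?thesis
    using that[of 0] norm_ge_zero order_trans by blast
qed

lemma matrix_inv_left_right:
  fixes W :: "real^'n^'n"
  assumes "invertible W"
  shows "matrix_inv W ** W = mat 1" "W ** matrix_inv W = mat 1"
  using assms unfolding invertible_def matrix_inv_def
  by (metis (mono_tags, lifting) someI_ex)+

text \<open>
  Cramer's rule for all columns at once. It shows that the entries of the inverse are rational
  functions of the entries of the matrix, whence continuity.
\<close>

lemma matrix_inv_cofactor:
  fixes W :: "real^'n^'n"
  assumes "invertible W"
  shows "matrix_inv W = (\<chi> k i. det (\<chi> p q. if q = k then axis i 1 $ p else W $ p $ q) / det W)"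
proof (subst vec_eq_iff, intro allI, subst vec_eq_iff, intro allI)
  fix k i
  have "W *v (matrix_inv W *v axis i 1) = axis i 1"
    by (simp add: matrix_vector_mul_assoc matrix_inv_left_right[OF assms])
  then have "matrix_inv W *v axis i 1
      = (\<chi> k. det (\<chi> p q. if q = k then axis i 1 $ p else W $ p $ q) / det W)"
    using cramer[of W "matrix_inv W *v axis i 1" "axis i 1"] assms by (simp add: invertible_det_nz)
  then show "matrix_inv W $ k $ i
      = (\<chi> k i. det (\<chi> p q. if q = k then axis i 1 $ p else W $ p $ q) / det W) $ k $ i"
    by (simp add: matrix_vector_mult_basis column_def vec_eq_iff)
qed

lemma continuous_on_matrix_inv [continuous_intros]:
  fixes W :: "'a::topological_space \<Rightarrow> real^'n^'n"
  assumes "continuous_on S W" "\<And>x. x \<in> S \<Longrightarrow> invertible (W x)"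
  shows "continuous_on S (\<lambda>x. matrix_inv (W x))"
proof -
  have W: "continuous_on S (\<lambda>x. W x $ i $ j)" for i j
    using assms(1) by (intro continuous_intros)
  have W_if: "continuous_on S (\<lambda>x. if b then a else W x $ i $ j)" for a b i j
    using W by (cases b) auto
  have "continuous_on S (\<lambda>x. \<chi> k i. det (\<chi> p q. if q = k then axis i 1 $ p else W x $ p $ q) / det (W x))"
    unfolding det_def
    by (intro continuous_on_vec_lambda continuous_on_divide continuous_on_sum continuous_on_mult
        continuous_on_prod continuous_on_const)
     (auto intro: W W_if simp: det_def[symmetric] assms(2)[unfolded invertible_det_nz])
  then show ?thesis
    using assms(2) by (simp add: matrix_inv_cofactor cong: continuous_on_cong)
qed

lemma psd_cone:
  "convex {M :: real^'n^'n. psd M}" "closed {M :: real^'n^'n. psd M}" "psd (0 :: real^'n^'n)"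
proof -
  show "psd (0 :: real^'n^'n)"
    by (simp add: psd_def sym_matrices_def matrix_algebra)
  show "convex {M :: real^'n^'n. psd M}"
    unfolding convex_def psd_def sym_matrices_def
    by (auto simp: matrix_algebra matrix_vector_mult_add_rdistrib scaleR_matrix_vector_assoc[symmetric] inner_add_right)
  have "linear (\<lambda>M :: real^'n^'n. x \<bullet> (M *v x))" for x
    by (auto intro!: linearI simp: matrix_vector_mult_add_rdistrib inner_add_right
        scaleR_matrix_vector_assoc[symmetric])
  then have form: "continuous_on UNIV (\<lambda>M :: real^'n^'n. x \<bullet> (M *v x))" for x
    by (simp add: linear_continuous_on linear_linear)
  have "closed ({M :: real^'n^'n. transpose M = M} \<inter> (\<Inter>x. {M. 0 \<le> x \<bullet> (M *v x)}))"
    by (intro closed_Int closed_INT ballI closed_Collect_eq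
        closed_Collect_le[OF continuous_on_const form] continuous_on_id
        linear_continuous_on bounded_linear_transpose)
  also have "{M :: real^'n^'n. transpose M = M} \<inter> (\<Inter>x. {M. 0 \<le> x \<bullet> (M *v x)}) = {M. psd M}"
    by (auto simp: psd_def sym_matrices_def)
  finally show "closed {M :: real^'n^'n. psd M}" .
qed

lemma psd_imp_transpose: "psd M \<Longrightarrow> transpose M = M"
  by (simp add: psd_def sym_matrices_def)

lemma psd_add: "psd M \<Longrightarrow> psd N \<Longrightarrow> psd (M + N)"
  by (auto simp: psd_def sym_matrices_def matrix_algebra matrix_vector_mult_add_rdistrib inner_add_right)

lemma psd_scaleR: "psd M \<Longrightarrow> 0 \<le> k \<Longrightarrow> psd (k *\<^sub>R M)"
  by (auto simp: psd_def sym_matrices_def matrix_algebra scaleR_matrix_vector_assoc[symmetric])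

lemma psd_congruence:
  fixes M :: "real^'n^'n" and N :: "real^'m^'n"
  assumes "psd M"
  shows "psd (transpose N ** M ** N)"
  using assms unfolding psd_def sym_matrices_def
  by (auto simp: matrix_algebra matrix_vector_mul_assoc[symmetric] inner_transpose_matrix_vector
      simp del: transpose_matrix_vector)

lemma psd_diag_nonneg: "psd M \<Longrightarrow> 0 \<le> M $ i $ i"
  unfolding psd_def using inner_axis_axis by (metis (no_types) cart_eq_inner_axis column_def inner_commute matrix_vector_mult_basis vec_lambda_beta)

lemma trace_eq_inner: "trace M = mat 1 \<bullet> (M :: real^'n^'n)"
  by (simp add: trace_def inner_vec_def mat_def if_distrib if_distribR cong: if_cong)

lemma psd_trace_nonneg: "psd M \<Longrightarrow> 0 \<le> trace M"
  by (simp add: trace_def sum_nonneg psd_diag_nonneg)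

text \<open>
  On the cone the trace controls the norm, which lets the a priori estimate for the Riccati equation
  be made for the scalar trace.
\<close>

lemma psd_norm_le_trace:
  fixes M :: "real^'n^'n"
  assumes "psd M"
  shows "norm M \<le> (real CARD('n))\<^sup>2 * trace M"
proof -
  have entry: "\<bar>M $ i $ j\<bar> \<le> trace M" for i j
  proof -
    have sym: "M $ i $ j = M $ j $ i"
      using assms unfolding psd_def sym_matrices_def
      by (metis (mono_tags, lifting) mem_Collect_eq transpose_def vec_lambda_beta)
    have le: "M $ k $ k \<le> trace M" for k
      unfolding trace_def using psd_diag_nonneg[OF assms] by (intro member_le_sum) auto
    \<comment> \<open>Testing the form at \<open>axis i 1 + axis j 1\<close> and \<open>axis i 1 - axis j 1\<close> bounds an entry by diagonal ones.\<close>
    have expand: "(axis i 1 + s *\<^sub>R axis j 1) \<bullet> (M *v (axis i 1 + s *\<^sub>R axis j 1))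
        = M $ i $ i + 2 * s * M $ i $ j + s * s * M $ j $ j" for s
      using sym
      by (simp add: matrix_vector_right_distrib matrix_vector_mult_scaleR matrix_vector_mult_basis
          inner_add_left inner_add_right inner_axis' column_def algebra_simps)
    have "0 \<le> M $ i $ i + 2 * s * M $ i $ j + s * s * M $ j $ j" for s
      using assms unfolding expand[symmetric] psd_def by blast
    from this[of 1] this[of "-1"] have "2 * \<bar>M $ i $ j\<bar> \<le> M $ i $ i + M $ j $ j"
      by auto
    then show ?thesis
      using le[of i] le[of j] by linarith
  qed
  have "norm M \<le> (\<Sum>i\<in>UNIV. norm (M $ i))"
    by (simp add: norm_vec_def L2_set_le_sum)
  also have "\<dots> \<le> (\<Sum>i\<in>(UNIV::'n set). \<Sum>j\<in>(UNIV::'n set). trace M)"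
    by (intro sum_mono order_trans[OF norm_le_l1_cart] entry)
  also have "\<dots> = (real CARD('n))\<^sup>2 * trace M"
    by (simp add: power2_eq_square)
  finally show ?thesis .
qed

text \<open>
  The projection to a centred ball rescales; hence it preserves every cone.
\<close>

lemma closest_point_cball_0:
  fixes x :: "'a::euclidean_space"
  assumes "0 < M"
  shows "closest_point (cball 0 M) x = (M / max M (norm x)) *\<^sub>R x"
proof (rule closest_point_unique[symmetric])
  let ?p = "(M / max M (norm x)) *\<^sub>R x"
  show "?p \<in> cball 0 M"
    using assms by (auto simp: max_def divide_le_eq)
  show "\<forall>z\<in>cball 0 M. dist x ?p \<le> dist x z"
  proof
    fix z :: 'a
    assume z: "z \<in> cball 0 M"
    show "dist x ?p \<le> dist x z"
    proof (cases "norm x \<le> M")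
      case True
      then have "?p = x"
        using assms by simp
      then show ?thesis
        by simp
    next
      case False
      then have "x \<noteq> 0"
        using assms by auto
      have "dist x ?p = norm ((1 - M / norm x) *\<^sub>R x)"
        using False by (simp add: dist_norm algebra_simps)
      also have "\<dots> = (1 - M / norm x) * norm x"
        using False assms by (simp add: abs_of_nonneg divide_le_eq)
      also have "\<dots> = norm x - M"
        using \<open>x \<noteq> 0\<close> by (simp add: field_simps)
      also have "\<dots> \<le> norm x - norm z"
        using z by simp
      also have "\<dots> \<le> dist x z"
        by (simp add: dist_norm norm_triangle_ineq2)
      finally show ?thesis .
    qed
  qed
qed (use assms in auto)

text \<open>
  Projection to the cone of positive semidefinite matrices, with normal \<open>N = X - Y\<close>. The cone is
  closed under addition, so \<open>N\<close> lies in its polar; it is invariant under congruences, so \<open>N\<close> is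
  orthogonal to the tangent space at \<open>Y\<close> of the congruence orbit of \<open>Y\<close>. These two facts are all
  that the invariance proof needs to know about the cone, and they avoid diagonalising matrices.
\<close>

lemma
  fixes X :: "real^'n^'n"
  defines "Y \<equiv> closest_point {M. psd M} X"
  shows psd_projection: "psd Y"
    and psd_polar: "psd W \<Longrightarrow> (X - Y) \<bullet> W \<le> 0"
    and psd_normal_tangent: "(X - Y) \<bullet> (Y ** E + transpose E ** Y) = 0"
proof -
  have ne: "{M :: real^'n^'n. psd M} \<noteq> {}"
    using psd_cone(3) by blast
  show Y: "psd Y"
    using closest_point_in_set[OF psd_cone(2) ne] by (simp add: Y_def)
  have normal: "(X - Y) \<bullet> (W - Y) \<le> 0" if "psd W" for W
    using closest_point_dot[OF psd_cone(1,2), of W X] that by (simp add: Y_def)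
  show polar: "(X - Y) \<bullet> W \<le> 0" if "psd W" for W
    using normal[OF psd_add[OF Y that]] by simp
  \<comment> \<open>The curve \<open>h \<mapsto> (I + h E)\<^sup>T Y (I + h E)\<close> stays in the cone for \<open>h\<close> of either sign, so the
    linear term of its inner product with the normal has to vanish.\<close>
  have eq: "transpose (mat 1 + h *\<^sub>R E) ** Y ** (mat 1 + h *\<^sub>R E)
      = Y + h *\<^sub>R (Y ** E + transpose E ** Y) + (h * h) *\<^sub>R (transpose E ** Y ** E)" for h
    by (simp add: matrix_algebra scaleR_add_right)
  have quad: "h * ((X - Y) \<bullet> (Y ** E + transpose E ** Y))
      + (h * h) * ((X - Y) \<bullet> (transpose E ** Y ** E)) \<le> 0" for h
    using normal[OF psd_congruence[OF Y, of "mat 1 + h *\<^sub>R E"]]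
    unfolding eq by (simp add: inner_add_right inner_diff_right)
  define u v where "u = (X - Y) \<bullet> (Y ** E + transpose E ** Y)"
    and "v = (X - Y) \<bullet> (transpose E ** Y ** E)"
  have "v \<le> 0"
    unfolding v_def by (rule polar[OF psd_congruence[OF Y]])
  have q: "h * u + (h * h) * v \<le> 0" for h
    using quad[of h] by (simp only: u_def v_def)
  have "u = 0"
  proof (rule ccontr)
    assume "u \<noteq> 0"
    \<comment> \<open>This \<open>h\<close> makes \<open>h * u + h * h * v\<close> equal to the square \<open>h * h\<close>.\<close>
    define h where "h = u / (1 - v)"
    have "1 - v > 0" using \<open>v \<le> 0\<close> by simp
    then have "h * (1 - v) = u"
      by (simp add: h_def)
    then have "h * u + (h * h) * v = h * (h * (1 - v)) + (h * h) * v"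
      by simp
    also have "\<dots> = h * h"
      by (simp add: algebra_simps)
    also have "\<dots> > 0"
      using \<open>u \<noteq> 0\<close> \<open>h * (1 - v) = u\<close> not_real_square_gt_zero[of h] by fastforce
    finally show False
      using q[of h] by simp
  qed
  then show "(X - Y) \<bullet> (Y ** E + transpose E ** Y) = 0"
    by (simp only: u_def)
qed

definition coercive :: "real \<Rightarrow> real^'n^'n \<Rightarrow> bool" where
  "coercive e M \<longleftrightarrow> (\<forall>x. e * (x \<bullet> x) \<le> x \<bullet> (M *v x))"

lemma coercive_add_psd: "coercive e M \<Longrightarrow> psd N \<Longrightarrow> coercive e (N + M)"
  unfolding coercive_def psd_def
  by (auto simp: matrix_vector_mult_add_rdistrib inner_add_right intro: add_increasing)

lemma coercive_mono: "coercive e M \<Longrightarrow> e' \<le> e \<Longrightarrow> coercive e' M"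
  unfolding coercive_def by (meson inner_ge_zero mult_right_mono order_trans)

lemma coercive_imp_invertible:
  fixes M :: "real^'n^'n"
  assumes "0 < e" "coercive e M"
  shows "invertible M"
proof -
  have "x = 0" if "M *v x = 0" for x
  proof -
    have "e * (x \<bullet> x) \<le> 0"
      using assms(2) that unfolding coercive_def by (metis inner_zero_right)
    then have "x \<bullet> x \<le> 0"
      using \<open>0 < e\<close> by (simp add: mult_le_0_iff)
    then show "x = 0"
      by (metis inner_eq_zero_iff inner_ge_zero order_antisym)
  qed
  then show ?thesis
    using invertible_left_inverse matrix_left_invertible_ker by blast
qed

lemma psd_if_coercive: "0 \<le> e \<Longrightarrow> coercive e M \<Longrightarrow> transpose M = M \<Longrightarrow> psd M"
  unfolding psd_def coercive_def sym_matrices_def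
  by (auto intro: order_trans[rotated])

text \<open>
  The set of times at which a continuous function takes values in the closed cone is closed, and a
  closed set containing almost every point of an open interval contains its closure.
\<close>

lemma psd_everywhere_if_ae_nonneg:
  fixes f :: "real \<Rightarrow> real^'n^'n"
  assumes "0 < T" "ae_nonneg T f" "continuous_on {0..T} f" and t: "t \<in> {0..T}"
  shows "psd (f t)"
proof -
  let ?C = "{s \<in> {0..T}. psd (f s)}"
  have closed: "closed ?C"
    using continuous_closed_preimage[OF assms(3) _ psd_cone(2)] by (simp add: vimage_def Int_def)
  have "AE s in lebesgue. s \<in> {0..T} \<longrightarrow> psd (f s)"
    using assms(2) unfolding ae_nonneg_def by (simp add: AE_restrict_space_iff)
  then have "AE s\<in>{0<..<T} in lebesgue. s \<in> ?C"
    by (rule AE_mp) (auto intro!: AE_I2)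
  then have "{0<..<T} \<subseteq> ?C"
    using mem_closed_if_AE_lebesgue_open[OF open_greaterThanLessThan closed] by blast
  then have "closure {0<..<T} \<subseteq> ?C"
    by (rule closure_minimal[OF _ closed])
  then show ?thesis
    using t \<open>0 < T\<close> by auto
qed

lemma ae_nonneg_iff_everywhere:
  assumes "0 < T" "continuous_on {0..T} f"
  shows "ae_nonneg T f \<longleftrightarrow> (\<forall>t\<in>{0..T}. psd (f t))"
proof
  assume "ae_nonneg T f"
  then show "\<forall>t\<in>{0..T}. psd (f t)"
    using psd_everywhere_if_ae_nonneg[OF assms(1) _ assms(2)] by blast
next
  assume "\<forall>t\<in>{0..T}. psd (f t)"
  then show "ae_nonneg T f"
    unfolding ae_nonneg_def by (intro AE_I2) (simp add: space_restrict_space)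
qed

lemma psd_diff_iff_coercive:
  "psd (M - e *\<^sub>R mat 1) \<longleftrightarrow> transpose M = M \<and> coercive e M"
  by (auto simp: psd_def sym_matrices_def coercive_def matrix_algebra matrix_vector_mult_diff_rdistrib
      inner_diff_right scaleR_matrix_vector_assoc[symmetric])

lemma uniformly_pos_iff:
  assumes "0 < T" "continuous_on {0..T} f"
  shows "uniformly_pos T f \<longleftrightarrow> (\<exists>e>0. \<forall>t\<in>{0..T}. transpose (f t) = f t \<and> coercive e (f t))"
proof
  assume "uniformly_pos T f"
  then obtain e where e: "0 < e" "ae_nonneg T (\<lambda>t. f t - e *\<^sub>R mat 1)"
    unfolding uniformly_pos_def by blast
  have "psd (f t - e *\<^sub>R mat 1)" if "t \<in> {0..T}" for t
    by (rule psd_everywhere_if_ae_nonneg[OF assms(1) e(2) _ that]) (intro continuous_intros assms(2))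
  then show "\<exists>e>0. \<forall>t\<in>{0..T}. transpose (f t) = f t \<and> coercive e (f t)"
    using e(1) unfolding psd_diff_iff_coercive by blast
next
  assume "\<exists>e>0. \<forall>t\<in>{0..T}. transpose (f t) = f t \<and> coercive e (f t)"
  then show "uniformly_pos T f"
    unfolding uniformly_pos_def ae_nonneg_def psd_diff_iff_coercive[symmetric]
    by (auto intro!: AE_I2 simp: space_restrict_space)
qed

section \<open>Block matrices\<close>

definition join_vec :: "real^'p \<Rightarrow> real^'r \<Rightarrow> real^('p + 'r)" where
  "join_vec x y = (\<chi> i. case i of Inl i' \<Rightarrow> x $ i' | Inr i' \<Rightarrow> y $ i')"

lemma join_vec_cases:
  obtains x y where "z = join_vec x y"
proof
  show "z = join_vec (\<chi> i. z $ Inl i) (\<chi> i. z $ Inr i)"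
    by (auto simp: join_vec_def vec_eq_iff split: sum.split)
qed

lemma all_join_vec: "(\<forall>z. P z) \<longleftrightarrow> (\<forall>x y. P (join_vec x y))"
  by (metis join_vec_cases)

lemma sum_UNIV_Plus:
  fixes f :: "'p::finite + 'r::finite \<Rightarrow> real"
  shows "sum f UNIV = (\<Sum>i\<in>UNIV. f (Inl i)) + (\<Sum>i\<in>UNIV. f (Inr i))"
  unfolding UNIV_Plus_UNIV[symmetric] by (subst sum.Plus) (auto simp: o_def)

lemma inner_join_vec: "join_vec x y \<bullet> join_vec x' y' = x \<bullet> x' + y \<bullet> y'"
  by (simp add: join_vec_def inner_vec_def sum_UNIV_Plus)

lemma block_mat_mult_join_vec:
  "block_mat A B C D *v join_vec x y = join_vec (A *v x + B *v y) (C *v x + D *v y)"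
  by (auto simp: block_mat_def join_vec_def matrix_vector_mult_def vec_eq_iff sum_UNIV_Plus split: sum.split)

lemma transpose_block_mat:
  "transpose (block_mat A B C D) = block_mat (transpose A) (transpose C) (transpose B) (transpose D)"
  by (auto simp: block_mat_def transpose_def vec_eq_iff split: sum.split)

lemma block_mat_eq_iff:
  "block_mat A B C D = block_mat A' B' C' D' \<longleftrightarrow> A = A' \<and> B = B' \<and> C = C' \<and> D = D'"
proof
  assume "block_mat A B C D = block_mat A' B' C' D'"
  then have *: "block_mat A B C D $ i $ j = block_mat A' B' C' D' $ i $ j" for i j
    by simp
  show "A = A' \<and> B = B' \<and> C = C' \<and> D = D'"
    using *[of "Inl _" "Inl _"] *[of "Inl _" "Inr _"] *[of "Inr _" "Inl _"] *[of "Inr _" "Inr _"]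
    by (simp add: block_mat_def vec_eq_iff)
qed simp

lemma continuous_on_block_mat:
  assumes "continuous_on Z A" "continuous_on Z B" "continuous_on Z C" "continuous_on Z D"
  shows "continuous_on Z (\<lambda>z. block_mat (A z) (B z) (C z) (D z))"
  unfolding block_mat_def
proof (intro continuous_on_vec_lambda)
  fix i j
  show "continuous_on Z (\<lambda>z. case i of
       Inl i' \<Rightarrow> (case j of Inl j' \<Rightarrow> A z $ i' $ j' | Inr j' \<Rightarrow> B z $ i' $ j')
     | Inr i' \<Rightarrow> (case j of Inl j' \<Rightarrow> C z $ i' $ j' | Inr j' \<Rightarrow> D z $ i' $ j'))"
    by (cases i; cases j) (use assms in \<open>auto intro!: continuous_on_component\<close>)
qed

lemma psd_block_mat_iff:
  fixes A :: "real^'n^'n" and B :: "real^'m^'n" and D :: "real^'m^'m"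
  shows "psd (block_mat A B (transpose B) D) \<longleftrightarrow> transpose A = A \<and> transpose D = D \<and>
    (\<forall>x u. 0 \<le> x \<bullet> (A *v x) + 2 * (x \<bullet> (B *v u)) + u \<bullet> (D *v u))"
proof -
  have form: "join_vec x u \<bullet> (block_mat A B (transpose B) D *v join_vec x u)
      = x \<bullet> (A *v x) + 2 * (x \<bullet> (B *v u)) + u \<bullet> (D *v u)" for x u
    by (simp add: block_mat_mult_join_vec inner_join_vec inner_add_right inner_transpose_matrix_vector
        del: transpose_matrix_vector) (simp add: inner_commute)
  show ?thesis
    unfolding psd_def sym_matrices_def mem_Collect_eq all_join_vec form
    by (auto simp: transpose_block_mat block_mat_eq_iff)
qed

lemma psd_block_diag_iff:
  fixes X :: "real^'n^'n" and Y :: "real^'m^'m"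
  shows "psd (block_diag X Y) \<longleftrightarrow> psd X \<and> psd Y"
proof -
  have "psd (block_diag X Y) \<longleftrightarrow> transpose X = X \<and> transpose Y = Y \<and>
    (\<forall>x u. 0 \<le> x \<bullet> (X *v x) + u \<bullet> (Y *v u))"
    using psd_block_mat_iff[of X 0 Y] by (simp add: block_diag_def matrix_algebra)
  also have "(\<forall>x u. 0 \<le> x \<bullet> (X *v x) + u \<bullet> (Y *v u)) \<longleftrightarrow>
      (\<forall>x. 0 \<le> x \<bullet> (X *v x)) \<and> (\<forall>u. 0 \<le> u \<bullet> (Y *v u))"
  proof safe
    fix x assume "\<forall>x u. 0 \<le> x \<bullet> (X *v x) + u \<bullet> (Y *v u)"
    from this[rule_format, of x 0] show "0 \<le> x \<bullet> (X *v x)"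
      by simp
  next
    fix u assume "\<forall>x u. 0 \<le> x \<bullet> (X *v x) + u \<bullet> (Y *v u)"
    from this[rule_format, of 0 u] show "0 \<le> u \<bullet> (Y *v u)"
      by simp
  qed (simp add: add_nonneg_nonneg)
  finally show ?thesis
    by (auto simp: psd_def sym_matrices_def)
qed

text \<open>
  The quadratic form of the large matrix is the sum of two forms in separate variables, so it is
  nonnegative exactly if both are. This decouples the two halves of the compensator condition.
\<close>

lemma psd_bordered_block_diag_iff:
  fixes Q :: "real^'n^'n" and S :: "real^'m^'n" and R :: "real^'m^'m"
    and Q' :: "real^'k^'k" and S' :: "real^'l^'k" and R' :: "real^'l^'l"
  shows "psd (block_mat (block_diag Q Q') (block_diag S S') (transpose (block_diag S S')) (block_diag R R'))
    \<longleftrightarrow> psd (block_mat Q S (transpose S) R) \<and> psd (block_mat Q' S' (transpose S') R')"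
  (is "?L \<longleftrightarrow> ?R")
proof -
  let ?f = "\<lambda>x u. x \<bullet> (Q *v x) + 2 * (x \<bullet> (S *v u)) + u \<bullet> (R *v u)"
  let ?g = "\<lambda>x u. x \<bullet> (Q' *v x) + 2 * (x \<bullet> (S' *v u)) + u \<bullet> (R' *v u)"
  have split: "join_vec x x' \<bullet> (block_diag Q Q' *v join_vec x x') +
      2 * (join_vec x x' \<bullet> (block_diag S S' *v join_vec u u')) +
      join_vec u u' \<bullet> (block_diag R R' *v join_vec u u') = ?f x u + ?g x' u'" for x x' u u'
    by (simp add: block_diag_def block_mat_mult_join_vec inner_join_vec)
  have "(\<forall>x x' u u'. 0 \<le> ?f x u + ?g x' u') \<longleftrightarrow> (\<forall>x u. 0 \<le> ?f x u) \<and> (\<forall>x u. 0 \<le> ?g x u)"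
  proof
    assume *: "\<forall>x x' u u'. 0 \<le> ?f x u + ?g x' u'"
    have "0 \<le> ?f x u" for x u
      using *[rule_format, of x u 0 0] by simp
    moreover have "0 \<le> ?g x u" for x u
      using *[rule_format, of 0 0 x u] by simp
    ultimately show "(\<forall>x u. 0 \<le> ?f x u) \<and> (\<forall>x u. 0 \<le> ?g x u)"
      by blast
  qed (blast intro: add_nonneg_nonneg)
  then show ?thesis
    unfolding psd_block_mat_iff all_join_vec split
    by (auto simp: block_diag_def transpose_block_mat block_mat_eq_iff matrix_algebra)
qed

lemma block_diag_diff_scaleR: "block_diag X Y - e *\<^sub>R mat 1 = block_diag (X - e *\<^sub>R mat 1) (Y - e *\<^sub>R mat 1)"
  by (auto simp: block_diag_def block_mat_def vec_eq_iff mat_def split: sum.split)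

lemma coercive_block_diag_iff: "coercive e (block_diag X Y) \<and> transpose (block_diag X Y) = block_diag X Y
   \<longleftrightarrow> (coercive e X \<and> transpose X = X) \<and> (coercive e Y \<and> transpose Y = Y)"
  using psd_block_diag_iff[of "X - e *\<^sub>R mat 1" "Y - e *\<^sub>R mat 1"]
  unfolding block_diag_diff_scaleR[symmetric] psd_diff_iff_coercive by blast

text \<open>
  With these off-diagonal blocks the form is \<open>(u - G x) \<bullet> W (u - G x)\<close>.
\<close>

lemma psd_square_completion:
  fixes W :: "real^'k^'k" and G :: "real^'l^'k"
  assumes "psd W"
  shows "psd (block_mat (transpose G ** W ** G) (- (transpose G ** W)) (transpose (- (transpose G ** W))) W)"
proof -
  have sym: "transpose W = W"
    by (rule psd_imp_transpose[OF assms])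
  have "x \<bullet> ((transpose G ** W ** G) *v x) + 2 * (x \<bullet> (- (transpose G ** W) *v u)) + u \<bullet> (W *v u)
      = (u - G *v x) \<bullet> (W *v (u - G *v x))" for x u
  proof -
    have 1: "x \<bullet> ((transpose G ** W ** G) *v x) = (G *v x) \<bullet> (W *v (G *v x))"
      by (simp add: matrix_mul_assoc[symmetric] matrix_vector_mul_assoc[symmetric]
          inner_transpose_matrix_vector del: transpose_matrix_vector)
    have 2: "x \<bullet> (- (transpose G ** W) *v u) = - ((G *v x) \<bullet> (W *v u))"
    proof -
      have "- (transpose G ** W) *v u = - (transpose G *v (W *v u))"
        by (metis add.right_inverse add_eq_0_iff matrix_vector_mul_assoc matrix_vector_mult_add_rdistrib matrix_vector_mult_0)
      then show ?thesis
        by (simp add: inner_transpose_matrix_vector del: transpose_matrix_vector)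
    qed
    have 3: "u \<bullet> (W *v (G *v x)) = (G *v x) \<bullet> (W *v u)"
      using inner_transpose_matrix_vector[of u W "G *v x"] unfolding sym by (simp add: inner_commute)
    show ?thesis
      unfolding 1 2 using 3 by (simp add: matrix_vector_mult_diff_distrib inner_diff_left inner_diff_right)
  qed
  then show ?thesis
    unfolding psd_block_mat_iff using assms by (auto simp: psd_def matrix_algebra sym)
qed

section \<open>Continuously differentiable matrix functions\<close>

lemma Linf_continuous_on: "f \<in> Linf T X \<Longrightarrow> continuous_on {0..T} f"
  by (simp add: Linf_def)

lemma Linf_mem: "f \<in> Linf T X \<Longrightarrow> t \<in> {0..T} \<Longrightarrow> f t \<in> X"
  by (auto simp: Linf_def)

text \<open>
  A continuous function on a compact interval is bounded, so its essential supremum is finite.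
\<close>

lemma continuous_mem_Linf:
  assumes "continuous_on {0..T} f" "\<And>t. t \<in> {0..T} \<Longrightarrow> f t \<in> X"
  shows "f \<in> Linf T X"
proof -
  obtain B where B: "\<forall>t\<in>{0..T}. norm (f t) \<le> B"
    using compact_imp_bounded[OF compact_continuous_image[OF assms(1) compact_Icc]]
    by (auto simp: bounded_iff)
  have "continuous_on {0..T} (\<lambda>t. ereal (norm (f t)))"
    by (intro continuous_on_ereal continuous_on_norm assms(1))
  then have "(\<lambda>t. ereal (norm (f t))) \<in> borel_measurable (lebesgue_on {0..T})"
    by (intro continuous_imp_measurable_on_sets_lebesgue) auto
  then have "esssup (lebesgue_on {0..T}) (\<lambda>t. ereal (norm (f t))) \<le> ereal B"
    by (rule esssup_I) (use B in \<open>auto intro!: AE_I2 simp: space_restrict_space\<close>)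
  then have "esssup (lebesgue_on {0..T}) (\<lambda>t. ereal (norm (f t))) < \<infinity>"
    by (rule order_le_less_trans) simp
  then show ?thesis
    using assms by (auto simp: Linf_def)
qed

lemma ddt_eqI:
  assumes "0 < T" "t \<in> {0..T}" "(F has_vector_derivative f) (at t within {0..T})"
  shows "ddt T F t = f"
  unfolding ddt_def by (rule vector_derivative_within_closed_interval[OF assms])

lemma ddt_has_vector_derivative:
  "continuously_differentiable T F \<Longrightarrow> t \<in> {0..T} \<Longrightarrow>
    (F has_vector_derivative ddt T F t) (at t within {0..T})"
  unfolding continuously_differentiable_def ddt_def by (simp add: vector_derivative_works)

lemma ddt_eq_iff:
  assumes "0 < T" "continuously_differentiable T F" "t \<in> {0..T}"
  shows "ddt T F t = f \<longleftrightarrow> (F has_vector_derivative f) (at t within {0..T})"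
  using ddt_has_vector_derivative[OF assms(2,3)] ddt_eqI[OF assms(1,3)] by auto

lemma continuously_differentiableI:
  assumes "0 < T" "continuous_on {0..T} f"
    and F: "\<And>t. t \<in> {0..T} \<Longrightarrow> (F has_vector_derivative f t) (at t within {0..T})"
  shows "continuously_differentiable T F"
  unfolding continuously_differentiable_def
proof
  show "\<forall>t\<in>{0..T}. F differentiable at t within {0..T}"
    using F by (blast intro: differentiableI_vector)
  show "continuous_on {0..T} (ddt T F)"
    by (rule continuous_on_eq[OF assms(2)]) (simp add: ddt_eqI[OF assms(1) _ F])
qed

text \<open>
  The density in the definition of \<open>Lam\<close> is continuous, so it is the derivative at every time.
\<close>

lemma Lam_derivative:
  assumes "0 < T" "F \<in> Lam T"
  shows "\<And>t. t \<in> {0..T} \<Longrightarrow> transpose (F t) = F t"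
    and "\<And>t. t \<in> {0..T} \<Longrightarrow> (F has_vector_derivative ddt T F t) (at t within {0..T})"
    and "continuous_on {0..T} (ddt T F)"
    and "\<And>t. t \<in> {0..T} \<Longrightarrow> transpose (ddt T F t) = ddt T F t"
proof -
  obtain f where f: "f \<in> Linf T sym_matrices" and F: "\<forall>t\<in>{0..T}. F t = F 0 + integral {0..t} f"
    using assms(2) unfolding Lam_def mem_Collect_eq by (elim conjE bexE)
  have der: "(F has_vector_derivative f t) (at t within {0..T})" if t: "t \<in> {0..T}" for t
  proof (rule has_vector_derivative_transform[OF t])
    show "F t = F 0 + integral {0..t} f" if "t \<in> {0..T}" for t
      using F that by blast
    show "((\<lambda>t. F 0 + integral {0..t} f) has_vector_derivative f t) (at t within {0..T})"
      using has_vector_derivative_add[OF has_vector_derivative_const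
          integral_has_vector_derivative[OF Linf_continuous_on[OF f] t]] by simp
  qed
  have eq: "ddt T F t = f t" if "t \<in> {0..T}" for t
    by (rule ddt_eqI[OF assms(1) that der[OF that]])
  show "transpose (F t) = F t" if "t \<in> {0..T}" for t
    using assms(2) that unfolding Lam_def sym_matrices_def Pi_iff mem_Collect_eq by (elim conjE bspec)
  show "(F has_vector_derivative ddt T F t) (at t within {0..T})" if "t \<in> {0..T}" for t
    using der[OF that] eq[OF that] by simp
  show "continuous_on {0..T} (ddt T F)"
    by (rule continuous_on_eq[OF Linf_continuous_on[OF f]]) (simp add: eq)
  show "transpose (ddt T F t) = ddt T F t" if "t \<in> {0..T}" for t
    using Linf_mem[OF f that] eq[OF that] by (simp add: sym_matrices_def)
qed

lemma Lam_if_continuously_differentiable: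
  assumes "0 < T" "continuous_on {0..T} f"
    and F: "\<And>t. t \<in> {0..T} \<Longrightarrow> (F has_vector_derivative f t) (at t within {0..T})"
    and sym: "\<And>t. t \<in> {0..T} \<Longrightarrow> transpose (F t) = F t" "\<And>t. t \<in> {0..T} \<Longrightarrow> transpose (f t) = f t"
  shows "F \<in> Lam T"
proof -
  have "F t = F 0 + integral {0..t} f" if "t \<in> {0..T}" for t
  proof -
    have "(f has_integral F t - F 0) {0..t}"
    proof (rule fundamental_theorem_of_calculus)
      fix v assume "v \<in> {0..t}"
      then show "(F has_vector_derivative f v) (at v within {0..t})"
        using that by (intro has_vector_derivative_within_subset[OF F]) auto
    qed (use that in simp)
    then show ?thesis
      by (simp add: integral_unique)
  qed
  moreover have "f \<in> Linf T sym_matrices"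
    by (rule continuous_mem_Linf[OF assms(2)]) (simp add: sym_matrices_def sym)
  ultimately show ?thesis
    using sym(1) unfolding Lam_def sym_matrices_def by blast
qed

section \<open>The stochastic Riccati equation\<close>

locale riccati_equation =
  fixes T :: real
    and a :: "real \<Rightarrow> real^'n^'n" and b :: "real \<Rightarrow> real^'m^'n"
    and c :: "real \<Rightarrow> real^'n^'n" and d :: "real \<Rightarrow> real^'m^'n"
    and q :: "real \<Rightarrow> real^'n^'n" and s :: "real \<Rightarrow> real^'m^'n" and r :: "real \<Rightarrow> real^'m^'m"
  assumes T_pos: "0 < T"
    and cont_a: "continuous_on {0..T} a" and cont_b: "continuous_on {0..T} b"
    and cont_c: "continuous_on {0..T} c" and cont_d: "continuous_on {0..T} d"
    and cont_q: "continuous_on {0..T} q" and cont_s: "continuous_on {0..T} s"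
    and cont_r: "continuous_on {0..T} r"
    and sym_q: "\<And>t. t \<in> {0..T} \<Longrightarrow> transpose (q t) = q t"
    and sym_r: "\<And>t. t \<in> {0..T} \<Longrightarrow> transpose (r t) = r t"

begin

definition lyap where "lyap t X = X ** a t + transpose (a t) ** X + transpose (c t) ** X ** c t + q t"

definition cross where "cross t X = X ** b t + transpose (c t) ** X ** d t + s t"

definition weight where "weight t X = transpose (d t) ** X ** d t + r t"

definition feedback where "feedback t X = - (matrix_inv (weight t X) ** transpose (cross t X))"

definition ric where
  "ric t X = lyap t X - transpose (feedback t X) ** weight t X ** feedback t X"

text \<open>
  The bilinear expression \<open>[I; G1]\<^sup>T M [I; G2]\<close> in two feedback gains, where \<open>M\<close> is the block matrix
  with blocks \<open>lyap t X\<close>, \<open>cross t X\<close> and \<open>weight t X\<close>, grouped so that the dependence on \<open>X\<close> and the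
  running cost \<open>[I; G1]\<^sup>T [q, s; s\<^sup>T, r] [I; G2]\<close> are visible.
\<close>

definition cost_form where
  "cost_form t X G1 G2 = X ** (a t + b t ** G2) + transpose (a t + b t ** G1) ** X
     + transpose (c t + d t ** G1) ** X ** (c t + d t ** G2)
     + (q t + s t ** G2 + transpose G1 ** transpose (s t) + transpose G1 ** r t ** G2)"

definition solution where
  "solution X \<longleftrightarrow> (\<forall>t\<in>{0..T}. transpose (X t) = X t \<and>
       (X has_vector_derivative - ric t (X t)) (at t within {0..T})) \<and>
     (\<exists>e>0. \<forall>t\<in>{0..T}. coercive e (weight t (X t)))"

lemma transpose_weight: "t \<in> {0..T} \<Longrightarrow> transpose X = X \<Longrightarrow> transpose (weight t X) = weight t X"
  by (simp add: weight_def matrix_algebra sym_r)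

lemma cost_form_expand:
  assumes "transpose X = X"
  shows "cost_form t X G1 G2 = lyap t X + cross t X ** G2 + transpose G1 ** transpose (cross t X)
    + transpose G1 ** weight t X ** G2"
  by (simp add: cost_form_def lyap_def cross_def weight_def matrix_algebra assms add_ac)

lemma weight_feedback:
  assumes "invertible (weight t X)"
  shows "weight t X ** feedback t X = - transpose (cross t X)"
  using matrix_inv_left_right(2)[OF assms]
  by (simp add: feedback_def matrix_algebra(1-10) matrix_mul_assoc)

text \<open>
  The feedback is the stationary point of the quadratic form of \<open>M\<close>: the block column
  \<open>M [I; feedback]\<close> is \<open>[ric; 0]\<close>, so the gain on the other side is multiplied by zero.
\<close>

lemma ric_eq_cost_form:
  assumes t: "t \<in> {0..T}" and X: "transpose X = X" and inv: "invertible (weight t X)"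
  shows "ric t X = cost_form t X (feedback t X) G" (is ?left)
    and "ric t X = cost_form t X G (feedback t X)" (is ?right)
proof -
  let ?g = "feedback t X" and ?W = "weight t X" and ?S = "cross t X"
  have wg: "?W ** ?g = - transpose ?S"
    by (rule weight_feedback[OF inv])
  then have "transpose (?W ** ?g) = - ?S"
    by (simp add: matrix_algebra(11-15))
  then have gw: "transpose ?g ** ?W = - ?S"
    by (simp add: matrix_transpose_mul transpose_weight[OF t X])
  have ric1: "ric t X = lyap t X + transpose ?g ** transpose ?S"
    unfolding ric_def matrix_mul_assoc[symmetric] wg by (simp add: matrix_algebra(1-10))
  have ric2: "ric t X = lyap t X + ?S ** ?g"
    unfolding ric_def gw by (simp add: matrix_algebra(1-10))
  show ?left
    unfolding cost_form_expand[OF X] gw by (simp add: ric1 matrix_algebra(1-10))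
  show ?right
    unfolding cost_form_expand[OF X] matrix_mul_assoc[symmetric] wg
    by (simp add: ric2 matrix_algebra(1-10))
qed

text \<open>
  Both values of \<open>ric\<close> are written with the same pair of gains, the feedback of \<open>X\<close> on the left and
  that of \<open>Y\<close> on the right. The running costs cancel, and what remains is linear in \<open>X - Y\<close>.
\<close>

lemma ric_diff:
  assumes t: "t \<in> {0..T}" and X: "transpose X = X" "invertible (weight t X)"
    and Y: "transpose Y = Y" "invertible (weight t Y)"
  shows "ric t X - ric t Y = (X - Y) ** (a t + b t ** feedback t Y)
    + transpose (a t + b t ** feedback t X) ** (X - Y)
    + transpose (c t + d t ** feedback t X) ** (X - Y) ** (c t + d t ** feedback t Y)"
proof -
  have "ric t X - ric t Y = cost_form t X (feedback t X) (feedback t Y)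
      - cost_form t Y (feedback t X) (feedback t Y)"
    using ric_eq_cost_form(1)[OF t X] ric_eq_cost_form(2)[OF t Y] by metis
  also have "\<dots> = (X - Y) ** (a t + b t ** feedback t Y)
    + transpose (a t + b t ** feedback t X) ** (X - Y)
    + transpose (c t + d t ** feedback t X) ** (X - Y) ** (c t + d t ** feedback t Y)"
    unfolding cost_form_def
    by (simp only: bounded_bilinear.diff_left[OF bounded_bilinear_matrix_matrix_mult]
        bounded_bilinear.diff_right[OF bounded_bilinear_matrix_matrix_mult]) (simp add: algebra_simps)
  finally show ?thesis .
qed

lemma continuous_on_coefficient:
  assumes "continuous_on {0..T} f" "continuous_on Z \<tau>" "\<tau> ` Z \<subseteq> {0..T}"
  shows "continuous_on Z (\<lambda>z. f (\<tau> z))"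
  by (rule continuous_on_compose2[OF assms])

lemma
  fixes \<tau> :: "'z::topological_space \<Rightarrow> real"
  assumes \<tau>: "continuous_on Z \<tau>" "\<tau> ` Z \<subseteq> {0..T}" and \<xi>: "continuous_on Z \<xi>"
  shows continuous_on_lyap: "continuous_on Z (\<lambda>z. lyap (\<tau> z) (\<xi> z))"
    and continuous_on_cross: "continuous_on Z (\<lambda>z. cross (\<tau> z) (\<xi> z))"
    and continuous_on_weight: "continuous_on Z (\<lambda>z. weight (\<tau> z) (\<xi> z))"
  unfolding lyap_def cross_def weight_def
  by (intro continuous_on_add continuous_on_matrix_mult continuous_on_transpose \<xi>
      continuous_on_coefficient[OF _ \<tau>] cont_a cont_b cont_c cont_d cont_q cont_s cont_r)+

text \<open>
  Time and matrix both depend on a parameter, which covers the behaviour along a curve as well as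
  joint continuity in time and matrix.
\<close>

lemma
  fixes \<tau> :: "'z::topological_space \<Rightarrow> real"
  assumes \<tau>: "continuous_on Z \<tau>" "\<tau> ` Z \<subseteq> {0..T}" and \<xi>: "continuous_on Z \<xi>"
    and inv: "\<And>z. z \<in> Z \<Longrightarrow> invertible (weight (\<tau> z) (\<xi> z))"
  shows continuous_on_feedback: "continuous_on Z (\<lambda>z. feedback (\<tau> z) (\<xi> z))"
    and continuous_on_ric: "continuous_on Z (\<lambda>z. ric (\<tau> z) (\<xi> z))"
proof -
  show fb: "continuous_on Z (\<lambda>z. feedback (\<tau> z) (\<xi> z))"
    unfolding feedback_def
    by (intro continuous_on_minus continuous_on_matrix_mult continuous_on_matrix_inv
        continuous_on_transpose continuous_on_cross continuous_on_weight \<tau> \<xi> inv)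
  show "continuous_on Z (\<lambda>z. ric (\<tau> z) (\<xi> z))"
    unfolding ric_def
    by (intro continuous_on_diff continuous_on_matrix_mult
        continuous_on_transpose continuous_on_lyap continuous_on_weight \<tau> \<xi> fb)
qed

lemma closed_loop_bounded:
  fixes \<tau> :: "'z::metric_space \<Rightarrow> real"
  assumes "compact Z" and \<tau>: "continuous_on Z \<tau>" "\<tau> ` Z \<subseteq> {0..T}" and \<xi>: "continuous_on Z \<xi>"
    and inv: "\<And>z. z \<in> Z \<Longrightarrow> invertible (weight (\<tau> z) (\<xi> z))"
  obtains B where "\<And>z. z \<in> Z \<Longrightarrow> norm (a (\<tau> z) + b (\<tau> z) ** feedback (\<tau> z) (\<xi> z)) \<le> B"
    "\<And>z. z \<in> Z \<Longrightarrow> norm (transpose (a (\<tau> z) + b (\<tau> z) ** feedback (\<tau> z) (\<xi> z))) \<le> B"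
    "\<And>z. z \<in> Z \<Longrightarrow> norm (c (\<tau> z) + d (\<tau> z) ** feedback (\<tau> z) (\<xi> z)) \<le> B"
    "\<And>z. z \<in> Z \<Longrightarrow> norm (transpose (c (\<tau> z) + d (\<tau> z) ** feedback (\<tau> z) (\<xi> z))) \<le> B"
proof -
  let ?E = "\<lambda>z. a (\<tau> z) + b (\<tau> z) ** feedback (\<tau> z) (\<xi> z)"
  let ?D = "\<lambda>z. c (\<tau> z) + d (\<tau> z) ** feedback (\<tau> z) (\<xi> z)"
  have fb: "continuous_on Z (\<lambda>z. feedback (\<tau> z) (\<xi> z))"
    by (rule continuous_on_feedback[OF \<tau> \<xi> inv])
  have E: "continuous_on Z ?E" and D: "continuous_on Z ?D"
    by (intro continuous_on_add continuous_on_matrix_mult fb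
        continuous_on_coefficient[OF _ \<tau>] cont_a cont_b cont_c cont_d)+
  have bd: "\<exists>B. \<forall>z\<in>Z. norm (f z) \<le> B" if "continuous_on Z f" for f :: "'z \<Rightarrow> real^'n^'n"
    using compact_imp_bounded[OF compact_continuous_image[OF that \<open>compact Z\<close>]]
    by (auto simp: bounded_iff)
  obtain B1 B2 B3 B4 where "\<forall>z\<in>Z. norm (?E z) \<le> B1" "\<forall>z\<in>Z. norm (transpose (?E z)) \<le> B2"
    "\<forall>z\<in>Z. norm (?D z) \<le> B3" "\<forall>z\<in>Z. norm (transpose (?D z)) \<le> B4"
    using bd[OF E] bd[OF D] bd[OF continuous_on_transpose[OF E]] bd[OF continuous_on_transpose[OF D]]
    by blast
  then show ?thesis
    by (intro that[of "max (max B1 B2) (max B3 B4)"]) (auto simp: le_max_iff_disj)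
qed

lemma solution_continuous_on: "solution X \<Longrightarrow> continuous_on {0..T} X"
  unfolding solution_def by (rule continuous_on_vector_derivative) blast

lemma continuous_on_ric_solution:
  assumes X: "solution X"
  shows "continuous_on {0..T} (\<lambda>t. ric t (X t))"
proof (rule continuous_on_ric[OF continuous_on_id _ solution_continuous_on[OF X]])
  show "invertible (weight t (X t))" if "t \<in> {0..T}" for t
    using X that coercive_imp_invertible unfolding solution_def by blast
qed simp

lemma solution_continuously_differentiable:
  assumes X: "solution X"
  shows "continuously_differentiable T X"
proof (rule continuously_differentiableI[OF T_pos])
  show "continuous_on {0..T} (\<lambda>t. - ric t (X t))"
    by (rule continuous_on_minus[OF continuous_on_ric_solution[OF X]])
  show "(X has_vector_derivative - ric t (X t)) (at t within {0..T})" if "t \<in> {0..T}" for t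
    using X that unfolding solution_def by blast
qed

lemma solution_Lam:
  assumes X: "solution X"
  shows "X \<in> Lam T"
proof (rule Lam_if_continuously_differentiable[OF T_pos])
  have sym: "transpose (X t) = X t" if "t \<in> {0..T}" for t
    using X that unfolding solution_def by blast
  show "continuous_on {0..T} (\<lambda>t. - ric t (X t))"
    by (rule continuous_on_minus[OF continuous_on_ric_solution[OF X]])
  fix t assume t: "t \<in> {0..T}"
  show "(X has_vector_derivative - ric t (X t)) (at t within {0..T})" "transpose (X t) = X t"
    using X t unfolding solution_def by blast+
  show "transpose (- ric t (X t)) = - ric t (X t)"
    using sym[OF t] sym_q[OF t] transpose_weight[OF t sym[OF t]]
    by (simp add: ric_def lyap_def matrix_algebra add_ac)
qed

text \<open>
  Along a solution the compensator block is the completed square with the feedback as gain. Its upper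
  left entry is \<open>X' + lyap\<close> with \<open>X'\<close> replaced by \<open>- ric\<close>.
\<close>

lemma solution_imp_psd_block:
  assumes X: "solution X" and t: "t \<in> {0..T}"
  shows "psd (block_mat (- ric t (X t) + lyap t (X t)) (cross t (X t)) (transpose (cross t (X t))) (weight t (X t)))"
proof -
  obtain e where e: "0 < e" "coercive e (weight t (X t))" and sym: "transpose (X t) = X t"
    using X t unfolding solution_def by blast
  let ?g = "feedback t (X t)" and ?W = "weight t (X t)"
  have symW: "transpose ?W = ?W"
    by (rule transpose_weight[OF t sym])
  have "transpose (?W ** ?g) = transpose (- transpose (cross t (X t)))"
    unfolding weight_feedback[OF coercive_imp_invertible[OF e]] ..
  then have cross: "- (transpose ?g ** ?W) = cross t (X t)"
    by (simp add: matrix_transpose_mul symW matrix_algebra(13))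
  have "- ric t (X t) + lyap t (X t) = transpose ?g ** ?W ** ?g"
    by (simp add: ric_def)
  then show ?thesis
    using psd_square_completion[OF psd_if_coercive[OF less_imp_le[OF e(1)] e(2) symW], of ?g]
    by (simp only: cross)
qed

text \<open>
  By \<open>ric_diff\<close> the difference of two solutions satisfies a linear homogeneous equation, whose
  coefficients are bounded because both feedbacks are continuous in time.
\<close>

theorem solution_unique:
  assumes X: "solution X" and Y: "solution Y" and "X T = Y T" and t: "t \<in> {0..T}"
  shows "X t = Y t"
proof -
  have inv: "invertible (weight t (Z t))" "transpose (Z t) = Z t" if "solution Z" "t \<in> {0..T}" for Z t
    using that coercive_imp_invertible unfolding solution_def by blast+
  have id: "continuous_on {0..T} (\<lambda>t. t)" "(\<lambda>t. t) ` {0..T} \<subseteq> {0..T}"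
    by (auto intro: continuous_on_id)
  note bounded = closed_loop_bounded[OF compact_Icc id]
  obtain B1 where B1: "\<And>t. t \<in> {0..T} \<Longrightarrow> norm (transpose (a t + b t ** feedback t (X t))) \<le> B1"
    "\<And>t. t \<in> {0..T} \<Longrightarrow> norm (transpose (c t + d t ** feedback t (X t))) \<le> B1"
    using bounded[OF solution_continuous_on[OF X] inv(1)[OF X]] by metis
  obtain B2 where B2: "\<And>t. t \<in> {0..T} \<Longrightarrow> norm (a t + b t ** feedback t (Y t)) \<le> B2"
    "\<And>t. t \<in> {0..T} \<Longrightarrow> norm (c t + d t ** feedback t (Y t)) \<le> B2"
    using bounded[OF solution_continuous_on[OF Y] inv(1)[OF Y]] by metis
  obtain C where C: "\<And>(M :: real^'n^'n) e1 e2 e3 e4. \<lbrakk>norm e1 \<le> max B1 B2; norm e2 \<le> max B1 B2;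
      norm e3 \<le> max B1 B2; norm e4 \<le> max B1 B2\<rbrakk> \<Longrightarrow>
      norm (M ** e1 + e2 ** M + e3 ** M ** e4) \<le> C * norm M"
    using two_sided_mult_bound[where B = "max B1 B2"] by metis
  have "X t - Y t = 0"
  proof (rule backward_gronwall_zero[where y = "\<lambda>t. X t - Y t" and C = C, OF _ _ _ t])
    fix t assume t: "t \<in> {0..T}"
    show "((\<lambda>t. X t - Y t) has_vector_derivative (- ric t (X t) - - ric t (Y t))) (at t within {0..T})"
      using X Y t unfolding solution_def by (intro has_vector_derivative_diff) blast+
    have "- ric t (X t) - - ric t (Y t) = - (ric t (X t) - ric t (Y t))"
      by simp
    then have "norm (- ric t (X t) - - ric t (Y t)) = norm (ric t (X t) - ric t (Y t))"
      by (metis norm_minus_cancel)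
    also have "\<dots> \<le> C * norm (X t - Y t)"
      unfolding ric_diff[OF t inv(2,1)[OF X t] inv(2,1)[OF Y t]]
      by (rule C) (use B1[OF t] B2[OF t] in auto)
    finally show "norm (- ric t (X t) - - ric t (Y t)) \<le> C * norm (X t - Y t)" .
  qed (use assms(3) in simp)
  then show ?thesis
    by simp
qed

text \<open>
  The a priori bound. The constant depends on the coefficients alone, in particular not on
  the region to which \<open>X\<close> is confined; this is what allows a truncation to be removed afterwards.
\<close>

lemma trace_ric_le:
  obtains C where "0 \<le> C"
    "\<And>t X. \<lbrakk>t \<in> {0..T}; psd (weight t X)\<rbrakk> \<Longrightarrow> trace (ric t X) \<le> C * (1 + norm X)"
proof -
  have bd: "\<exists>B. \<forall>t\<in>{0..T}. norm (f t) \<le> B" if "continuous_on {0..T} f" for f :: "real \<Rightarrow> real^'n^'n"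
    using compact_imp_bounded[OF compact_continuous_image[OF that compact_Icc]]
    by (auto simp: bounded_iff)
  obtain B1 B2 B3 B4 B5 where B: "\<forall>t\<in>{0..T}. norm (a t) \<le> B1"
      "\<forall>t\<in>{0..T}. norm (transpose (a t)) \<le> B2" "\<forall>t\<in>{0..T}. norm (c t) \<le> B3"
      "\<forall>t\<in>{0..T}. norm (transpose (c t)) \<le> B4" "\<forall>t\<in>{0..T}. norm (q t) \<le> B5"
    using bd[OF cont_a] bd[OF cont_c] bd[OF cont_q] bd[OF continuous_on_transpose[OF cont_a]]
      bd[OF continuous_on_transpose[OF cont_c]] by blast
  define B where "B = max (max B1 B2) (max B3 B4)"
  obtain C0 where C0: "0 \<le> C0" "\<And>(X :: real^'n^'n) e1 e2 e3 e4. \<lbrakk>norm e1 \<le> B; norm e2 \<le> B; norm e3 \<le> B; norm e4 \<le> B\<rbrakk> \<Longrightarrow>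
      norm (X ** e1 + e2 ** X + e3 ** X ** e4) \<le> C0 * norm X"
    using two_sided_mult_bound[where B = B] by metis
  have "0 \<le> B5"
    using B(5) T_pos norm_ge_zero[of "q 0"] by (meson atLeastAtMost_iff less_imp_le order_refl order_trans)
  show ?thesis
  proof
    let ?I = "mat 1 :: real^'n^'n"
    show "0 \<le> norm ?I * (C0 + B5)"
      using C0(1) \<open>0 \<le> B5\<close> by simp
    fix t X
    assume t: "t \<in> {0..T}" and W: "psd (weight t X)"
    \<comment> \<open>The quadratic term of \<open>ric\<close> enters with a favourable sign; only the affine part is estimated.\<close>
    have "trace (ric t X) = trace (lyap t X) - trace (transpose (feedback t X) ** weight t X ** feedback t X)"
      by (simp add: ric_def trace_sub)
    also have "\<dots> \<le> trace (lyap t X)"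
      using psd_trace_nonneg[OF psd_congruence[OF W]] by simp
    also have "\<dots> \<le> norm ?I * norm (lyap t X)"
      unfolding trace_eq_inner by (rule norm_cauchy_schwarz)
    also have "\<dots> \<le> norm ?I * (C0 * norm X + B5)"
    proof (rule mult_left_mono)
      have "norm (X ** a t + transpose (a t) ** X + transpose (c t) ** X ** c t) \<le> C0 * norm X"
        by (rule C0(2)) (use B t in \<open>auto simp: B_def le_max_iff_disj\<close>)
      then show "norm (lyap t X) \<le> C0 * norm X + B5"
        unfolding lyap_def using B(5) t norm_triangle_le[of _ "q t"] by (meson add_mono order_trans norm_triangle_ineq)
    qed simp
    also have "\<dots> \<le> norm ?I * ((C0 + B5) * (1 + norm X))"
    proof (rule mult_left_mono)
      have "0 \<le> B5 * norm X"
        using \<open>0 \<le> B5\<close> by simp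
      then show "C0 * norm X + B5 \<le> (C0 + B5) * (1 + norm X)"
        using C0(1) by (simp add: algebra_simps)
    qed simp
    finally show "trace (ric t X) \<le> norm ?I * (C0 + B5) * (1 + norm X)"
      by (simp only: mult.assoc)
  qed
qed

lemma ric_lipschitz:
  assumes e: "0 < e" "\<And>t. t \<in> {0..T} \<Longrightarrow> coercive e (r t)"
  obtains L where "0 \<le> L" "\<And>t X Y. \<lbrakk>t \<in> {0..T}; psd X; psd Y; norm X \<le> M; norm Y \<le> M\<rbrakk> \<Longrightarrow>
    norm (ric t X - ric t Y) \<le> L * norm (X - Y)"
proof -
  have inv: "invertible (weight t X)" if "t \<in> {0..T}" "psd X" for t X
    unfolding weight_def
    by (rule coercive_imp_invertible[OF e(1) coercive_add_psd[OF e(2)[OF that(1)] psd_congruence[OF that(2)]]])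
  let ?Z = "{0..T} \<times> ({X :: real^'n^'n. psd X} \<inter> cball 0 M)"
  have "compact ?Z"
    by (intro compact_Times compact_Icc closed_Int_compact psd_cone(2) compact_cball)
  then obtain B where B: "\<And>z. z \<in> ?Z \<Longrightarrow> norm (a (fst z) + b (fst z) ** feedback (fst z) (snd z)) \<le> B"
    "\<And>z. z \<in> ?Z \<Longrightarrow> norm (transpose (a (fst z) + b (fst z) ** feedback (fst z) (snd z))) \<le> B"
    "\<And>z. z \<in> ?Z \<Longrightarrow> norm (c (fst z) + d (fst z) ** feedback (fst z) (snd z)) \<le> B"
    "\<And>z. z \<in> ?Z \<Longrightarrow> norm (transpose (c (fst z) + d (fst z) ** feedback (fst z) (snd z))) \<le> B"
    by (rule closed_loop_bounded[where \<tau> = fst and \<xi> = snd])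
      (auto intro: inv continuous_on_fst continuous_on_snd continuous_on_id)
  obtain C where C: "0 \<le> C" "\<And>(M :: real^'n^'n) e1 e2 e3 e4. \<lbrakk>norm e1 \<le> B; norm e2 \<le> B;
      norm e3 \<le> B; norm e4 \<le> B\<rbrakk> \<Longrightarrow> norm (M ** e1 + e2 ** M + e3 ** M ** e4) \<le> C * norm M"
    using two_sided_mult_bound[where B = B] by metis
  show ?thesis
  proof
    fix t and X Y :: "real^'n^'n"
    assume A: "t \<in> {0..T}" "psd X" "psd Y" "norm X \<le> M" "norm Y \<le> M"
    then have Z: "(t, X) \<in> ?Z" "(t, Y) \<in> ?Z"
      by auto
    show "norm (ric t X - ric t Y) \<le> C * norm (X - Y)"
      unfolding ric_diff[OF A(1) psd_imp_transpose[OF A(2)] inv[OF A(1,2)] psd_imp_transpose[OF A(3)] inv[OF A(1,3)]]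
      using B[OF Z(1)] B[OF Z(2)] by (intro C(2)) simp_all
  qed (rule C(1))
qed

text \<open>
  Here the running cost and the terminal value are nonnegative, so the solution, which is a value
  function, should be nonnegative too. Only there is the weight known to be invertible, so the
  equation is first solved with its argument projected to a bounded part of the cone.
\<close>

theorem solution_exists_psd:
  assumes e: "0 < e" "\<And>t. t \<in> {0..T} \<Longrightarrow> coercive e (r t)"
    and nonneg: "\<And>t x u. t \<in> {0..T} \<Longrightarrow> 0 \<le> x \<bullet> (q t *v x) + 2 * (x \<bullet> (s t *v u)) + u \<bullet> (r t *v u)"
    and G: "psd G"
  obtains X where "solution X" "X T = G" "\<And>t. t \<in> {0..T} \<Longrightarrow> psd (X t)"
proof -
  let ?PSD = "{M :: real^'n^'n. psd M}"
  let ?k = "(real CARD('n))\<^sup>2"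
  have PSD: "convex ?PSD" "closed ?PSD" "?PSD \<noteq> {}"
    using psd_cone by auto
  have k0: "0 \<le> ?k"
    by simp
  have coer: "coercive e (weight t X)" if "t \<in> {0..T}" "psd X" for t X
    unfolding weight_def by (rule coercive_add_psd[OF e(2)[OF that(1)] psd_congruence[OF that(2)]])
  have inv: "invertible (weight t X)" if "t \<in> {0..T}" "psd X" for t X
    by (rule coercive_imp_invertible[OF e(1) coer[OF that]])
  have weight_psd: "psd (weight t X)" if "t \<in> {0..T}" "psd X" for t X
    using psd_if_coercive[OF less_imp_le[OF e(1)] coer[OF that]]
      transpose_weight[OF that(1) psd_imp_transpose[OF that(2)]] .
  obtain C where C: "0 \<le> C" "\<And>t X. \<lbrakk>t \<in> {0..T}; psd (weight t X)\<rbrakk> \<Longrightarrow> trace (ric t X) \<le> C * (1 + norm X)"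
    using trace_ric_le by metis
  \<comment> \<open>\<open>M\<close> is the Gronwall bound for the trace proved below. Since \<open>C\<close> depends on the coefficients
    only, \<open>M\<close> can be fixed before the equation is truncated.\<close>
  define M where "M = exp (?k * C * T) * (1 + ?k * trace G)"
  have M: "0 < M"
    using psd_trace_nonneg[OF G] by (simp add: M_def add_pos_nonneg)
  \<comment> \<open>Both projections are nonexpansive, and the second only rescales a positive semidefinite
    matrix, so \<open>\<rho>\<close> is a nonexpansive map into the bounded piece of the cone on which \<open>ric\<close> is Lipschitz.\<close>
  define \<rho> where "\<rho> = (\<lambda>X :: real^'n^'n. closest_point (cball 0 M) (closest_point ?PSD X))"
  have \<rho>_eq: "\<rho> X = (M / max M (norm (closest_point ?PSD X))) *\<^sub>R closest_point ?PSD X" for X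
    unfolding \<rho>_def by (rule closest_point_cball_0[OF M])
  have \<rho>_psd: "psd (\<rho> X)" for X
    unfolding \<rho>_eq using M by (intro psd_scaleR psd_projection) simp
  have cball: "convex (cball (0::real^'n^'n) M)" "closed (cball (0::real^'n^'n) M)" "cball (0::real^'n^'n) M \<noteq> {}"
    using M by auto
  have \<rho>_M: "norm (\<rho> X) \<le> M" for X
    using closest_point_in_set[OF cball(2,3)] by (simp add: \<rho>_def)
  have \<rho>_lip: "norm (\<rho> X - \<rho> Y) \<le> norm (X - Y)" for X Y
    using order_trans[OF closest_point_lipschitz[OF cball] closest_point_lipschitz[OF PSD]]
    by (simp add: \<rho>_def dist_norm)
  have \<rho>_cont: "continuous_on Z (\<lambda>z. \<rho> (\<xi> z))" if "continuous_on Z \<xi>" for Z and \<xi> :: "real \<Rightarrow> real^'n^'n"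
    unfolding \<rho>_def
    by (rule continuous_on_compose2[OF continuous_on_closest_point[OF cball, where t = UNIV]
          continuous_on_compose2[OF continuous_on_closest_point[OF PSD, where t = UNIV] that]])
      auto
  obtain L where L: "0 \<le> L" "\<And>t X Y. \<lbrakk>t \<in> {0..T}; psd X; psd Y; norm X \<le> M; norm Y \<le> M\<rbrakk> \<Longrightarrow>
      norm (ric t X - ric t Y) \<le> L * norm (X - Y)"
    using ric_lipschitz[OF e] by metis
  have lip: "norm (ric t (\<rho> X) - ric t (\<rho> Y)) \<le> L * norm (X - Y)" if "t \<in> {0..T}" for t X Y
  proof -
    have "norm (ric t (\<rho> X) - ric t (\<rho> Y)) \<le> L * norm (\<rho> X - \<rho> Y)"
      by (rule L(2)[OF that \<rho>_psd \<rho>_psd \<rho>_M \<rho>_M])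
    also have "\<dots> \<le> L * norm (X - Y)"
      by (rule mult_left_mono[OF \<rho>_lip L(1)])
    finally show ?thesis .
  qed
  have cont: "continuous_on {0..T} (\<lambda>t. ric t (\<rho> (y t)))" if "continuous_on {0..T} y" for y
    by (rule continuous_on_ric[OF continuous_on_id _ \<rho>_cont[OF that] inv[OF _ \<rho>_psd]]) auto
  obtain y where y: "y T = G"
    "\<And>t. t \<in> {0..T} \<Longrightarrow> (y has_vector_derivative - ric t (\<rho> (y t))) (at t within {0..T})"
    using backward_picard_lindelof[where f = "\<lambda>t X. ric t (\<rho> X)", OF T_pos cont lip] by blast
  have stage: "psd (q t + s t ** G + transpose G ** transpose (s t) + transpose G ** r t ** G)"
    if "t \<in> {0..T}" for t and G :: "real^'n^'m"
  proof -
    have "x \<bullet> ((q t + s t ** G + transpose G ** transpose (s t) + transpose G ** r t ** G) *v x)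
        = x \<bullet> (q t *v x) + 2 * (x \<bullet> (s t *v (G *v x))) + (G *v x) \<bullet> (r t *v (G *v x))" for x
      by (simp add: matrix_vector_mult_add_rdistrib inner_add_right matrix_vector_mul_assoc[symmetric]
          inner_transpose_matrix_vector del: transpose_matrix_vector) (simp add: inner_commute)
    moreover have "transpose (q t + s t ** G + transpose G ** transpose (s t) + transpose G ** r t ** G)
        = q t + s t ** G + transpose G ** transpose (s t) + transpose G ** r t ** G"
      using sym_q[OF that] sym_r[OF that] by (simp add: matrix_algebra add_ac)
    ultimately show ?thesis
      using nonneg[OF that] by (simp add: psd_def sym_matrices_def)
  qed
  \<comment> \<open>The cone is invariant: the normal \<open>?N\<close> at the projection is orthogonal to the part of \<open>ric\<close>
    tangent to the congruence orbit and has nonpositive inner product with the other two summands.\<close>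
  have psd: "psd (y t)" if "t \<in> {0..T}" for t
  proof -
    have "y t \<in> ?PSD"
    proof (rule backward_invariance_closed_convex[OF PSD y(2) _ _ that])
      fix t assume t: "t \<in> {0..T}"
      let ?Y = "closest_point ?PSD (y t)" and ?N = "y t - closest_point ?PSD (y t)" and ?Z = "\<rho> (y t)"
      define g where "g = feedback t ?Z"
      define E where "E = a t + b t ** g"
      have "?N \<bullet> (?Z ** E + transpose E ** ?Z)
          = (M / max M (norm ?Y)) * (?N \<bullet> (?Y ** E + transpose E ** ?Y))"
        unfolding \<rho>_eq by (simp add: matrix_algebra(7,8) scaleR_add_right[symmetric])
      then have 1: "?N \<bullet> (?Z ** E + transpose E ** ?Z) = 0"
        by (simp add: psd_normal_tangent)
      have 2: "?N \<bullet> (transpose (c t + d t ** g) ** ?Z ** (c t + d t ** g)) \<le> 0"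
        by (rule psd_polar[OF psd_congruence[OF \<rho>_psd]])
      have 3: "?N \<bullet> (q t + s t ** g + transpose g ** transpose (s t) + transpose g ** r t ** g) \<le> 0"
        by (rule psd_polar[OF stage[OF t]])
      have "ric t ?Z = (?Z ** E + transpose E ** ?Z) + transpose (c t + d t ** g) ** ?Z ** (c t + d t ** g)
          + (q t + s t ** g + transpose g ** transpose (s t) + transpose g ** r t ** g)"
        using ric_eq_cost_form(1)[OF t psd_imp_transpose[OF \<rho>_psd] inv[OF t \<rho>_psd], of "y t" g]
        unfolding cost_form_def g_def[symmetric] E_def .
      then show "?N \<bullet> ric t ?Z \<le> 0"
        using 1 2 3 by (simp only: inner_add_right)
    qed (use y(1) G in auto)
    then show ?thesis
      by simp
  qed
  \<comment> \<open>Gronwall for \<open>1 + ?k * trace (y t)\<close>, which dominates \<open>1 + norm (y t)\<close> on the cone.\<close>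
  have bound: "norm (y t) \<le> M" if "t \<in> {0..T}" for t
  proof -
    define g where "g = (\<lambda>t. exp (?k * C * t) * (1 + ?k * trace (y t)))"
    have "g t \<le> g T"
    proof (rule within_derivative_nonneg_imp_le[where f = g])
      fix v assume v: "v \<in> {t..T}"
      then have v': "v \<in> {0..T}"
        using that by auto
      let ?Z = "\<rho> (y v)"
      have d: "(y has_vector_derivative - ric v ?Z) (at v within {t..T})"
        using y(2)[OF v'] that by (auto intro: has_vector_derivative_within_subset)
      have "bounded_linear (trace :: real^'n^'n \<Rightarrow> real)"
        unfolding trace_eq_inner by (rule bounded_linear_inner_right)
      then have tr: "((\<lambda>t. trace (y t)) has_vector_derivative trace (- ric v ?Z)) (at v within {t..T})"
        by (rule bounded_linear.has_vector_derivative[OF _ d])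
      have ex: "((\<lambda>t. exp (?k * C * t)) has_vector_derivative ?k * C * exp (?k * C * v)) (at v within {t..T})"
        by (auto intro!: derivative_eq_intros simp: has_real_derivative_iff_has_vector_derivative[symmetric])
      have "((\<lambda>t. 1 + ?k * trace (y t)) has_vector_derivative 0 + ?k * trace (- ric v ?Z)) (at v within {t..T})"
        by (rule has_vector_derivative_add[OF has_vector_derivative_const
              bounded_linear.has_vector_derivative[OF bounded_linear_mult_right tr]])
      from has_vector_derivative_mult[OF ex this]
      show "(g has_vector_derivative (exp (?k * C * v) * (0 + ?k * trace (- ric v ?Z))
          + ?k * C * exp (?k * C * v) * (1 + ?k * trace (y v)))) (at v within {t..T})"
        unfolding g_def .
      have "closest_point ?PSD (y v) = y v"
        using psd[OF v'] by (simp add: closest_point_self)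
      then have "norm ?Z \<le> norm (y v)"
        unfolding \<rho>_eq using M by (simp add: divide_le_eq mult_left_le_one_le max_def)
      also have "\<dots> \<le> ?k * trace (y v)"
        by (rule psd_norm_le_trace[OF psd[OF v']])
      finally have "C * (1 + norm ?Z) \<le> C * (1 + ?k * trace (y v))"
        using C(1) by (intro mult_left_mono) auto
      then have "trace (ric v ?Z) \<le> C * (1 + ?k * trace (y v))"
        using C(2)[OF v' weight_psd[OF v' \<rho>_psd]] by (rule order_trans[rotated])
      then have "0 \<le> exp (?k * C * v) * ?k * (C * (1 + ?k * trace (y v)) - trace (ric v ?Z))"
        by simp
      also have "\<dots> = exp (?k * C * v) * (0 + ?k * trace (- ric v ?Z))
          + ?k * C * exp (?k * C * v) * (1 + ?k * trace (y v))"
        unfolding trace_eq_inner by (simp add: algebra_simps)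
      finally show "0 \<le> exp (?k * C * v) * (0 + ?k * trace (- ric v ?Z))
          + ?k * C * exp (?k * C * v) * (1 + ?k * trace (y v))" .
    qed (use that in auto)
    then have gM: "g t \<le> M"
      by (simp add: g_def M_def y(1))
    have tr0: "0 \<le> ?k * trace (y t)"
      using psd_trace_nonneg[OF psd[OF that]] by simp
    have "norm (y t) \<le> ?k * trace (y t)"
      by (rule psd_norm_le_trace[OF psd[OF that]])
    also have "\<dots> \<le> 1 * (1 + ?k * trace (y t))"
      by simp
    also have "\<dots> \<le> g t"
      unfolding g_def using tr0 C(1) k0 that by (intro mult_right_mono) auto
    finally show ?thesis
      using gM by linarith
  qed
  have \<rho>_y: "\<rho> (y t) = y t" if "t \<in> {0..T}" for t
    using psd[OF that] bound[OF that] by (simp add: \<rho>_def closest_point_self)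
  show ?thesis
  proof
    show "solution y"
      unfolding solution_def
    proof (intro conjI ballI exI[of _ e])
      fix t assume t: "t \<in> {0..T}"
      show "transpose (y t) = y t"
        by (rule psd_imp_transpose[OF psd[OF t]])
      show "(y has_vector_derivative - ric t (y t)) (at t within {0..T})"
        using y(2)[OF t] by (simp only: \<rho>_y[OF t])
      show "coercive e (weight t (y t))"
        by (rule coer[OF t psd[OF t]])
    qed (rule e(1))
  qed (use y(1) psd in auto)
qed

text \<open>
  The change of variable \<open>X = P - H\<close> preserves the form of the equation. It replaces \<open>q\<close>, \<open>s\<close>, \<open>r\<close> by the
  compensator blocks \<open>H' + lyap H\<close>, \<open>cross H\<close>, \<open>weight H\<close>, which are nonnegative by assumption.
\<close>

theorem solution_exists_above:
  assumes e: "0 < e" "\<And>t. t \<in> {0..T} \<Longrightarrow> coercive e (weight t (H t))"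
    and H: "\<And>t. t \<in> {0..T} \<Longrightarrow> transpose (H t) = H t"
      "\<And>t. t \<in> {0..T} \<Longrightarrow> (H has_vector_derivative h t) (at t within {0..T})"
    and h: "continuous_on {0..T} h" "\<And>t. t \<in> {0..T} \<Longrightarrow> transpose (h t) = h t"
    and nonneg: "\<And>t x u. t \<in> {0..T} \<Longrightarrow>
      0 \<le> x \<bullet> ((h t + lyap t (H t)) *v x) + 2 * (x \<bullet> (cross t (H t) *v u)) + u \<bullet> (weight t (H t) *v u)"
    and G: "psd (G - H T)"
  obtains P where "solution P" "P T = G" "\<And>t. t \<in> {0..T} \<Longrightarrow> psd (P t - H t)"
proof -
  have contH: "continuous_on {0..T} H"
    by (rule continuous_on_vector_derivative[OF H(2)])
  have id: "continuous_on {0..T} (\<lambda>t. t)" "(\<lambda>t. t) ` {0..T} \<subseteq> {0..T}"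
    by (auto intro: continuous_on_id)
  interpret shifted: riccati_equation T a b c d
    "\<lambda>t. h t + lyap t (H t)" "\<lambda>t. cross t (H t)" "\<lambda>t. weight t (H t)"
  proof
    show "continuous_on {0..T} (\<lambda>t. h t + lyap t (H t))"
      by (intro continuous_on_add h(1) continuous_on_lyap[OF id contH])
    show "transpose (h t + lyap t (H t)) = h t + lyap t (H t)" if "t \<in> {0..T}" for t
      using H(1)[OF that] h(2)[OF that] sym_q[OF that] by (simp add: lyap_def matrix_algebra add_ac)
  qed (use T_pos cont_a cont_b cont_c cont_d continuous_on_cross[OF id contH]
      continuous_on_weight[OF id contH] transpose_weight H(1) in auto)
  have weight: "shifted.weight t X = weight t (H t + X)" for t X
    unfolding shifted.weight_def unfolding weight_def by (simp add: matrix_algebra add_ac)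
  have cross: "shifted.cross t X = cross t (H t + X)" for t X
    unfolding shifted.cross_def unfolding cross_def by (simp add: matrix_algebra add_ac)
  have lyap: "shifted.lyap t X = h t + lyap t (H t + X)" for t X
    unfolding shifted.lyap_def unfolding lyap_def by (simp add: matrix_algebra add_ac)
  have ric: "shifted.ric t X = h t + ric t (H t + X)" for t X
    unfolding shifted.ric_def shifted.feedback_def weight cross lyap unfolding ric_def feedback_def by simp
  obtain X where X: "shifted.solution X" "X T = G - H T" "\<And>t. t \<in> {0..T} \<Longrightarrow> psd (X t)"
    using shifted.solution_exists_psd[OF e nonneg G] by blast
  show ?thesis
  proof
    show "solution (\<lambda>t. H t + X t)"
      unfolding solution_def
    proof (intro conjI ballI)
      fix t assume t: "t \<in> {0..T}"
      show "transpose (H t + X t) = H t + X t"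
        using H(1)[OF t] psd_imp_transpose[OF X(3)[OF t]] by (simp add: matrix_algebra)
      have "(X has_vector_derivative - shifted.ric t (X t)) (at t within {0..T})"
        using X(1) t unfolding shifted.solution_def by blast
      from has_vector_derivative_add[OF H(2)[OF t] this]
      show "((\<lambda>t. H t + X t) has_vector_derivative - ric t (H t + X t)) (at t within {0..T})"
        by (simp add: ric)
    next
      show "\<exists>e>0. \<forall>t\<in>{0..T}. coercive e (weight t (H t + X t))"
        using X(1) unfolding shifted.solution_def weight by blast
    qed
  qed (use X in auto)
qed

end

lemma riccati_equation_solution_cong:
  assumes "riccati_equation T a b c d q s r" "riccati_equation T a b c d q' s' r'"
    and eq: "\<And>t. t \<in> {0..T} \<Longrightarrow> q t = q' t \<and> s t = s' t \<and> r t = r' t"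
    and sol: "riccati_equation.solution T a b c d q s r X"
  shows "riccati_equation.solution T a b c d q' s' r' X"
proof -
  interpret e: riccati_equation T a b c d q s r by (rule assms(1))
  interpret f: riccati_equation T a b c d q' s' r' by (rule assms(2))
  have weight: "f.weight t Y = e.weight t Y" if "t \<in> {0..T}" for t Y
    using eq[OF that] by (simp add: e.weight_def f.weight_def)
  have ric: "f.ric t Y = e.ric t Y" if "t \<in> {0..T}" for t Y
    using eq[OF that]
    by (simp add: e.ric_def f.ric_def e.lyap_def f.lyap_def e.feedback_def f.feedback_def
        e.cross_def f.cross_def weight[OF that])
  show ?thesis
    using sol ric weight unfolding e.solution_def f.solution_def by simp
qed

section \<open>The mean-field system\<close>

locale mflq_problem =
  fixes T :: real and d :: "('n::finite, 'm::finite) mflq"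
  assumes horizon_pos: "0 < T" and data: "mflq_data T d"

begin

lemma coefficients_continuous:
  "continuous_on {0..T} (cA d)" "continuous_on {0..T} (cB d)" "continuous_on {0..T} (cC d)"
  "continuous_on {0..T} (cD d)" "continuous_on {0..T} (cQ d)" "continuous_on {0..T} (cS d)"
  "continuous_on {0..T} (cR d)"
  "continuous_on {0..T} (hA d)" "continuous_on {0..T} (hB d)" "continuous_on {0..T} (hC d)"
  "continuous_on {0..T} (hD d)" "continuous_on {0..T} (hQ d)" "continuous_on {0..T} (hS d)"
  "continuous_on {0..T} (hR d)"
  using data unfolding mflq_data_def hA_def hB_def hC_def hD_def hQ_def hS_def hR_def
  by (auto intro!: continuous_on_add dest!: Linf_continuous_on)

lemma coefficients_symmetric:
  "t \<in> {0..T} \<Longrightarrow> transpose (cQ d t) = cQ d t" "t \<in> {0..T} \<Longrightarrow> transpose (cR d t) = cR d t"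
  "t \<in> {0..T} \<Longrightarrow> transpose (hQ d t) = hQ d t" "t \<in> {0..T} \<Longrightarrow> transpose (hR d t) = hR d t"
  "transpose (cG d) = cG d" "transpose (hG d) = hG d"
  using data Linf_mem[of _ T "sym_matrices :: (real^'n^'n) set" t]
    Linf_mem[of _ T "sym_matrices :: (real^'m^'m) set" t]
  unfolding mflq_data_def hQ_def hR_def hG_def sym_matrices_def
  by (auto simp: matrix_algebra)

sublocale plain: riccati_equation T "cA d" "cB d" "cC d" "cD d" "cQ d" "cS d" "cR d"
  by unfold_locales (auto intro: horizon_pos coefficients_continuous coefficients_symmetric)

abbreviation (input) meanQ where "meanQ P \<equiv> \<lambda>t. transpose (hC d t) ** P t ** hC d t + hQ d t"

abbreviation (input) meanS where "meanS P \<equiv> \<lambda>t. transpose (hC d t) ** P t ** hD d t + hS d t"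

abbreviation (input) meanR where "meanR P \<equiv> \<lambda>t. transpose (hD d t) ** P t ** hD d t + hR d t"

text \<open>
  The second equation of the system: the matrix \<open>P\<close> enters only through the weights, and the quadratic
  term is that of a deterministic problem, without diffusion coefficients.
\<close>

lemma mean_equation:
  assumes "continuous_on {0..T} P" "\<And>t. t \<in> {0..T} \<Longrightarrow> transpose (P t) = P t"
  shows "riccati_equation T (hA d) (hB d) (\<lambda>_. 0) (\<lambda>_. 0) (meanQ P) (meanS P) (meanR P)"
  by unfold_locales
    (auto intro!: horizon_pos continuous_on_add continuous_on_matrix_mult continuous_on_transpose
      coefficients_continuous assms(1) continuous_on_const simp: coefficients_symmetric assms(2) matrix_algebra)

abbreviation (input) mean_solution where
  "mean_solution P \<equiv> riccati_equation.solution T (hA d) (hB d) (\<lambda>_. 0) (\<lambda>_. 0) (meanQ P) (meanS P) (meanR P)"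

lemma riccati_system_iff:
  "riccati_system T d P Ph \<longleftrightarrow>
    plain.solution P \<and> P T = cG d \<and> mean_solution P Ph \<and> Ph T = hG d"
  (is "?L \<longleftrightarrow> ?R")
proof -
  have gam: "Gam d t X = plain.feedback t X" for t X
    by (simp add: Gam_def plain.feedback_def plain.weight_def plain.cross_def)
  have main: "?L \<longleftrightarrow> ?R" if P: "continuous_on {0..T} P" "\<And>t. t \<in> {0..T} \<Longrightarrow> transpose (P t) = P t"
  proof -
    interpret mean: riccati_equation T "hA d" "hB d" "\<lambda>_. 0" "\<lambda>_. 0" "meanQ P" "meanS P" "meanR P"
      by (rule mean_equation[OF P])
    have hgam: "hGam d t (P t) X = mean.feedback t X" for t X
      by (simp add: hGam_def mean.feedback_def mean.weight_def mean.cross_def matrix_algebra(9,10) add.assoc)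
    have id: "continuous_on {0..T} (\<lambda>t. t)" "(\<lambda>t. t) ` {0..T} \<subseteq> {0..T}"
      by (auto intro: continuous_on_id)
    have up: "uniformly_pos T (\<lambda>t. transpose (cD d t) ** P t ** cD d t + cR d t) \<longleftrightarrow>
        (\<exists>e>0. \<forall>t\<in>{0..T}. coercive e (plain.weight t (P t)))"
      using uniformly_pos_iff[OF horizon_pos plain.continuous_on_weight[OF id P(1)]]
        plain.transpose_weight P(2) by (simp add: plain.weight_def)
    have hup: "uniformly_pos T (\<lambda>t. transpose (hD d t) ** P t ** hD d t + hR d t) \<longleftrightarrow>
        (\<exists>e>0. \<forall>t\<in>{0..T}. coercive e (mean.weight t (Ph t)))"
      using uniformly_pos_iff[OF horizon_pos mean.cont_r] mean.sym_r
      unfolding mean.weight_def by (simp add: matrix_algebra(9,10))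
    have cd: "continuously_differentiable T P \<and>
        (\<forall>t\<in>{0..T}. ddt T P t + P t ** cA d t + transpose (cA d t) ** P t
          + transpose (cC d t) ** P t ** cC d t + cQ d t
          - transpose (Gam d t (P t)) ** (transpose (cD d t) ** P t ** cD d t + cR d t) ** Gam d t (P t) = 0)
      \<longleftrightarrow> continuously_differentiable T P \<and>
        (\<forall>t\<in>{0..T}. (P has_vector_derivative - plain.ric t (P t)) (at t within {0..T}))"
    proof -
      have "ddt T P t + P t ** cA d t + transpose (cA d t) ** P t
          + transpose (cC d t) ** P t ** cC d t + cQ d t
          - transpose (Gam d t (P t)) ** (transpose (cD d t) ** P t ** cD d t + cR d t) ** Gam d t (P t) = ddt T P t + plain.ric t (P t)" for t
        unfolding plain.ric_def plain.lyap_def gam plain.weight_def[symmetric]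
        by (simp add: add_ac diff_conv_add_uminus del: add_uminus_conv_diff)
      then have eqv: "(ddt T P t + P t ** cA d t + transpose (cA d t) ** P t
          + transpose (cC d t) ** P t ** cC d t + cQ d t
          - transpose (Gam d t (P t)) ** (transpose (cD d t) ** P t ** cD d t + cR d t) ** Gam d t (P t) = 0)
        \<longleftrightarrow> ddt T P t = - plain.ric t (P t)" for t
        by (simp only: eq_neg_iff_add_eq_0)
      show ?thesis
        unfolding eqv by (intro conj_cong refl ball_cong ddt_eq_iff[OF horizon_pos])
    qed
    have hcd: "continuously_differentiable T Ph \<and>
        (\<forall>t\<in>{0..T}. ddt T Ph t + Ph t ** hA d t + transpose (hA d t) ** Ph t
          + transpose (hC d t) ** P t ** hC d t + hQ d t
          - transpose (hGam d t (P t) (Ph t)) ** (transpose (hD d t) ** P t ** hD d t + hR d t)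
            ** hGam d t (P t) (Ph t) = 0)
      \<longleftrightarrow> continuously_differentiable T Ph \<and>
        (\<forall>t\<in>{0..T}. (Ph has_vector_derivative - mean.ric t (Ph t)) (at t within {0..T}))"
    proof -
      have weight: "mean.weight t (Ph t) = transpose (hD d t) ** P t ** hD d t + hR d t" for t
        unfolding mean.weight_def by (simp add: matrix_algebra(9,10))
      have "ddt T Ph t + Ph t ** hA d t + transpose (hA d t) ** Ph t
          + transpose (hC d t) ** P t ** hC d t + hQ d t
          - transpose (hGam d t (P t) (Ph t)) ** (transpose (hD d t) ** P t ** hD d t + hR d t)
            ** hGam d t (P t) (Ph t) = ddt T Ph t + mean.ric t (Ph t)" for t
        unfolding mean.ric_def mean.lyap_def hgam weight
        by (simp add: add_ac diff_conv_add_uminus del: add_uminus_conv_diff add: matrix_algebra(9,10))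
      then have eqv: "(ddt T Ph t + Ph t ** hA d t + transpose (hA d t) ** Ph t
          + transpose (hC d t) ** P t ** hC d t + hQ d t
          - transpose (hGam d t (P t) (Ph t)) ** (transpose (hD d t) ** P t ** hD d t + hR d t)
            ** hGam d t (P t) (Ph t) = 0)
        \<longleftrightarrow> ddt T Ph t = - mean.ric t (Ph t)" for t
        by (simp only: eq_neg_iff_add_eq_0)
      show ?thesis
        unfolding eqv by (intro conj_cong refl ball_cong ddt_eq_iff[OF horizon_pos])
    qed
    have sol: "plain.solution P \<longleftrightarrow> continuously_differentiable T P \<and> P \<in> {0..T} \<rightarrow> sym_matrices \<and>
        (\<forall>t\<in>{0..T}. (P has_vector_derivative - plain.ric t (P t)) (at t within {0..T})) \<and>
        (\<exists>e>0. \<forall>t\<in>{0..T}. coercive e (plain.weight t (P t)))"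
      using plain.solution_continuously_differentiable[of P]
      unfolding plain.solution_def sym_matrices_def by blast
    have hsol: "mean.solution Ph \<longleftrightarrow> continuously_differentiable T Ph \<and> Ph \<in> {0..T} \<rightarrow> sym_matrices \<and>
        (\<forall>t\<in>{0..T}. (Ph has_vector_derivative - mean.ric t (Ph t)) (at t within {0..T})) \<and>
        (\<exists>e>0. \<forall>t\<in>{0..T}. coercive e (mean.weight t (Ph t)))"
      using mean.solution_continuously_differentiable[of Ph]
      unfolding mean.solution_def sym_matrices_def by blast
    show ?thesis
      unfolding riccati_system_def sol hsol up hup using cd hcd by argo
  qed
  show ?thesis
  proof
    assume L: ?L
    then have "continuous_on {0..T} P" "\<And>t. t \<in> {0..T} \<Longrightarrow> transpose (P t) = P t"
      unfolding riccati_system_def sym_matrices_def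
      by (blast intro: continuous_on_vector_derivative ddt_has_vector_derivative)+
    from main[OF this] L show ?R by blast
  next
    assume R: ?R
    then have "continuous_on {0..T} P" "\<And>t. t \<in> {0..T} \<Longrightarrow> transpose (P t) = P t"
      using plain.solution_continuous_on unfolding plain.solution_def by blast+
    from main[OF this] R show ?L by blast
  qed
qed

text \<open>
  The two second equations have weights built from \<open>P\<close> and \<open>P'\<close>. These agree on \<open>[0,T]\<close> once uniqueness
  for the first equation is known, and only then can the second solutions be compared.
\<close>

lemma riccati_system_unique:
  assumes "riccati_system T d P Ph" "riccati_system T d P' Ph'" "t \<in> {0..T}"
  shows "P' t = P t \<and> Ph' t = Ph t"
proof -
  note S = conjunct1[OF assms(1)[unfolded riccati_system_iff]]
    conjunct2[OF assms(1)[unfolded riccati_system_iff]]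
  note S' = conjunct1[OF assms(2)[unfolded riccati_system_iff]]
    conjunct2[OF assms(2)[unfolded riccati_system_iff]]
  have terminal: "P' T = P T" "Ph' T = Ph T"
    using S(2) S'(2) by simp_all
  have eq: "P' v = P v" if "v \<in> {0..T}" for v
    by (rule plain.solution_unique[OF S'(1) S(1) terminal(1) that])
  have eqn: "riccati_equation T (hA d) (hB d) (\<lambda>_. 0) (\<lambda>_. 0) (meanQ Z) (meanS Z) (meanR Z)"
    if "plain.solution Z" for Z
    using mean_equation[OF plain.solution_continuous_on[OF that]] that
    unfolding plain.solution_def by blast
  interpret mean: riccati_equation T "hA d" "hB d" "\<lambda>_. 0" "\<lambda>_. 0" "meanQ P" "meanS P" "meanR P"
    by (rule eqn[OF S(1)])
  have "mean_solution P' Ph'" and Ph: "mean.solution Ph"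
    using S(2) S'(2) by simp_all
  then have Ph': "mean.solution Ph'"
    by (intro riccati_equation_solution_cong[OF eqn[OF S'(1)] mean.riccati_equation_axioms])
      (simp_all add: eq)
  have "Ph' t = Ph t"
    by (rule mean.solution_unique[OF Ph' Ph terminal(2) assms(3)])
  then show ?thesis
    using eq[OF assms(3)] by blast
qed

text \<open>
  All data are continuous, so the conditions almost everywhere hold at every time, and the
  doubled blocks separate into a condition for each of the two equations.
\<close>

lemma relaxed_compensator_iff:
  assumes "H \<in> Lam T" "K \<in> Lam T"
  shows "relaxed_compensator T d H K \<longleftrightarrow>
    (\<forall>t\<in>{0..T}. psd (block_mat (ddt T H t + plain.lyap t (H t)) (plain.cross t (H t))
       (transpose (plain.cross t (H t))) (plain.weight t (H t)))) \<and>
    (\<forall>t\<in>{0..T}. psd (block_mat (ddt T K t + K t ** hA d t + transpose (hA d t) ** K t + meanQ H t)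
       (K t ** hB d t + meanS H t) (transpose (K t ** hB d t + meanS H t)) (meanR H t))) \<and>
    (\<exists>e>0. \<forall>t\<in>{0..T}. coercive e (plain.weight t (H t)) \<and> coercive e (meanR H t)) \<and>
    psd (cG d - H T) \<and> psd (hG d - K T)"
proof -
  note H = Lam_derivative[OF horizon_pos assms(1)] and K = Lam_derivative[OF horizon_pos assms(2)]
  have contH: "continuous_on {0..T} H"
    by (rule continuous_on_vector_derivative[OF H(2)])
  have contK: "continuous_on {0..T} K"
    by (rule continuous_on_vector_derivative[OF K(2)])
  have contb: "continuous_on {0..T} (bQ T d H K)" "continuous_on {0..T} (bS d H K)" "continuous_on {0..T} (bR d H)"
    unfolding bQ_def bS_def bR_def block_diag_def
    by (intro continuous_on_block_mat continuous_on_add continuous_on_matrix_mult continuous_on_transpose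
      coefficients_continuous contH contK H(3) K(3) continuous_on_const)+
  have symR: "transpose (bR d H t) = bR d H t" if "t \<in> {0..T}" for t
    using H(1)[OF that] coefficients_symmetric(2,4)[OF that]
    by (simp add: bR_def block_diag_def transpose_block_mat matrix_algebra)
  have "uniformly_pos T (bR d H) \<longleftrightarrow> (\<exists>e>0. \<forall>t\<in>{0..T}. coercive e (bR d H t) \<and> transpose (bR d H t) = bR d H t)"
    using uniformly_pos_iff[OF horizon_pos contb(3)] by blast
  also have "\<dots> \<longleftrightarrow> (\<exists>e>0. \<forall>t\<in>{0..T}. coercive e (plain.weight t (H t)) \<and> coercive e (meanR H t))"
  proof -
    have sym: "transpose (plain.weight t (H t)) = plain.weight t (H t)"
      "transpose (meanR H t) = meanR H t" if "t \<in> {0..T}" for t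
      using plain.transpose_weight[OF that H(1)[OF that]] H(1)[OF that] coefficients_symmetric(4)[OF that]
      by (simp_all add: matrix_algebra)
    show ?thesis
      unfolding bR_def coercive_block_diag_iff plain.weight_def[symmetric]
      by (intro ex_cong1 conj_cong refl ball_cong) (simp_all only: sym simp_thms)
  qed
  finally have R: "uniformly_pos T (bR d H) \<longleftrightarrow> (\<exists>e>0. \<forall>t\<in>{0..T}. coercive e (plain.weight t (H t)) \<and> coercive e (meanR H t))" .
  let ?M = "\<lambda>t. block_mat (bQ T d H K t) (bS d H K t) (transpose (bS d H K t)) (bR d H t)"
  have "continuous_on {0..T} ?M"
    by (intro continuous_on_block_mat continuous_on_transpose contb)
  then have "ae_nonneg T ?M \<longleftrightarrow> (\<forall>t\<in>{0..T}. psd (?M t))"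
    by (rule ae_nonneg_iff_everywhere[OF horizon_pos])
  then have Q: "ae_nonneg T ?M \<longleftrightarrow>
    (\<forall>t\<in>{0..T}. psd (block_mat (ddt T H t + plain.lyap t (H t)) (plain.cross t (H t))
       (transpose (plain.cross t (H t))) (plain.weight t (H t)))) \<and>
    (\<forall>t\<in>{0..T}. psd (block_mat (ddt T K t + K t ** hA d t + transpose (hA d t) ** K t + meanQ H t)
       (K t ** hB d t + meanS H t) (transpose (K t ** hB d t + meanS H t)) (meanR H t)))"
    unfolding bQ_def bS_def bR_def psd_bordered_block_diag_iff
      plain.lyap_def plain.cross_def plain.weight_def
    by (simp add: add.assoc ball_conj_distrib)
  show ?thesis
    unfolding relaxed_compensator_def Q R bG_def psd_block_diag_iff using assms by blast
qed

lemma compensator_imp_riccati: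
  assumes "relaxed_compensator T d H K"
  obtains P Ph where "riccati_system T d P Ph"
proof -
  have Lam: "H \<in> Lam T" "K \<in> Lam T"
    using assms by (auto simp: relaxed_compensator_def)
  note H = Lam_derivative[OF horizon_pos Lam(1)] and K = Lam_derivative[OF horizon_pos Lam(2)]
  note conds = assms[unfolded relaxed_compensator_iff[OF Lam] psd_block_mat_iff]
  obtain e where e: "0 < e" "\<And>t. t \<in> {0..T} \<Longrightarrow> coercive e (plain.weight t (H t))"
    "\<And>t. t \<in> {0..T} \<Longrightarrow> coercive e (meanR H t)"
    using conds by blast
  obtain P where P: "plain.solution P" "P T = cG d" "\<And>t. t \<in> {0..T} \<Longrightarrow> psd (P t - H t)"
    by (rule plain.solution_exists_above[OF e(1,2) H(1,2,3,4), where G = "cG d"]) (use conds in blast)+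
  have contP: "continuous_on {0..T} P" "\<And>t. t \<in> {0..T} \<Longrightarrow> transpose (P t) = P t"
    using P(1) plain.solution_continuous_on unfolding plain.solution_def by blast+
  interpret mean: riccati_equation T "hA d" "hB d" "\<lambda>_. 0" "\<lambda>_. 0" "meanQ P" "meanS P" "meanR P"
    by (rule mean_equation[OF contP])
  have R: "meanR P t = transpose (hD d t) ** (P t - H t) ** hD d t + meanR H t" for t
    by (simp add: matrix_algebra)
  have weight: "mean.weight t X = meanR P t" for t X
    unfolding mean.weight_def by (simp add: matrix_algebra(9,10))
  have cross: "mean.cross t X = (X ** hB d t + meanS H t) + transpose (hC d t) ** (P t - H t) ** hD d t" for t X
    unfolding mean.cross_def by (simp add: matrix_algebra add_ac)
  have lyap: "ddt T K t + mean.lyap t X = (ddt T K t + X ** hA d t + transpose (hA d t) ** X + meanQ H t)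
      + transpose (hC d t) ** (P t - H t) ** hC d t" for t X
    unfolding mean.lyap_def by (simp add: matrix_algebra add_ac)
  obtain Ph where Ph: "mean.solution Ph" "Ph T = hG d"
  proof (rule mean.solution_exists_above[OF e(1) _ K(1,2,3,4), where G = "hG d"])
    fix t assume t: "t \<in> {0..T}"
    show "coercive e (mean.weight t (K t))"
      unfolding weight unfolding R by (rule coercive_add_psd[OF e(3)[OF t] psd_congruence[OF P(3)[OF t]]])
    fix x u
    let ?D = "P t - H t" and ?z = "hC d t *v x + hD d t *v u"
    have nonneg_regroup: "0 \<le> (p1 + p2) + 2 * (q1 + q2) + (r2 + r1)"
      if "p2 + 2 * q2 + r2 = z" "0 \<le> z" "0 \<le> p1 + 2 * q1 + r1" for p1 p2 q1 q2 r1 r2 z :: real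
      using that by (simp add: algebra_simps)
    have symD: "transpose ?D = ?D"
      by (rule psd_imp_transpose[OF P(3)[OF t]])
    have move: "(hD d t *v u) \<bullet> (?D *v (hC d t *v x)) = (hC d t *v x) \<bullet> (?D *v (hD d t *v u))"
      using inner_transpose_matrix_vector[of "hD d t *v u" ?D "hC d t *v x"] unfolding symD
      by (simp add: inner_commute)
    \<comment> \<open>Replacing \<open>H\<close> by \<open>P\<close> in the averaged block adds the form of \<open>P - H\<close> at \<open>?z\<close>, which is nonnegative.\<close>
    have "x \<bullet> ((transpose (hC d t) ** ?D ** hC d t) *v x) + 2 * (x \<bullet> ((transpose (hC d t) ** ?D ** hD d t) *v u))
        + u \<bullet> ((transpose (hD d t) ** ?D ** hD d t) *v u) = ?z \<bullet> (?D *v ?z)"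
      using move by (simp add: matrix_mul_assoc[symmetric] matrix_vector_mul_assoc[symmetric]
          inner_transpose_matrix_vector matrix_vector_right_distrib inner_add_left inner_add_right
          del: transpose_matrix_vector)
    moreover have "0 \<le> ?z \<bullet> (?D *v ?z)"
      using P(3)[OF t] by (simp add: psd_def)
    moreover have "0 \<le> x \<bullet> ((ddt T K t + K t ** hA d t + transpose (hA d t) ** K t + meanQ H t) *v x)
        + 2 * (x \<bullet> ((K t ** hB d t + meanS H t) *v u)) + u \<bullet> (meanR H t *v u)"
      using conds t by blast
    ultimately show "0 \<le> x \<bullet> ((ddt T K t + mean.lyap t (K t)) *v x) + 2 * (x \<bullet> (mean.cross t (K t) *v u))
        + u \<bullet> (mean.weight t (K t) *v u)"
      unfolding weight cross lyap unfolding R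
        bilinear_form_add[of x _ "transpose (hC d t) ** ?D ** hC d t"]
        bilinear_form_add[of x _ "transpose (hC d t) ** ?D ** hD d t"]
        bilinear_form_add[of u "transpose (hD d t) ** ?D ** hD d t" "meanR H t"]
      by (rule nonneg_regroup)
  qed (use conds in blast)+
  show ?thesis
    using that P(1,2) Ph unfolding riccati_system_iff by blast
qed

lemma riccati_imp_compensator:
  assumes "riccati_system T d P Ph"
  shows "relaxed_compensator T d P Ph"
proof -
  note S = assms[unfolded riccati_system_iff]
  have contP: "continuous_on {0..T} P" "\<And>t. t \<in> {0..T} \<Longrightarrow> transpose (P t) = P t"
    using S plain.solution_continuous_on unfolding plain.solution_def by blast+
  interpret mean: riccati_equation T "hA d" "hB d" "\<lambda>_. 0" "\<lambda>_. 0" "meanQ P" "meanS P" "meanR P"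
    by (rule mean_equation[OF contP])
  have P: "plain.solution P" "P T = cG d" and Ph: "mean.solution Ph" "Ph T = hG d"
    using S by blast+
  have weight: "mean.weight t X = meanR P t" for t X
    unfolding mean.weight_def by (simp add: matrix_algebra(9,10))
  have cross: "mean.cross t X = X ** hB d t + meanS P t" for t X
    unfolding mean.cross_def by (simp add: matrix_algebra(9,10))
  have lyap: "mean.lyap t X = X ** hA d t + transpose (hA d t) ** X + meanQ P t" for t X
    unfolding mean.lyap_def by (simp add: matrix_algebra(9,10))
  have Lam: "P \<in> Lam T" "Ph \<in> Lam T"
    by (rule plain.solution_Lam[OF P(1)], rule mean.solution_Lam[OF Ph(1)])
  have dP: "ddt T P t = - plain.ric t (P t)" "ddt T Ph t = - mean.ric t (Ph t)" if "t \<in> {0..T}" for t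
    using P(1) Ph(1) ddt_eqI[OF horizon_pos that] that
    unfolding plain.solution_def mean.solution_def by blast+
  obtain e1 e2 where e: "0 < e1" "\<forall>t\<in>{0..T}. coercive e1 (plain.weight t (P t))"
    "0 < e2" "\<forall>t\<in>{0..T}. coercive e2 (meanR P t)"
    using P(1) Ph(1) unfolding plain.solution_def mean.solution_def weight by blast
  show ?thesis
    unfolding relaxed_compensator_iff[OF Lam]
  proof (intro conjI ballI exI[of _ "min e1 e2"])
    fix t assume t: "t \<in> {0..T}"
    show "psd (block_mat (ddt T P t + plain.lyap t (P t)) (plain.cross t (P t))
       (transpose (plain.cross t (P t))) (plain.weight t (P t)))"
      unfolding dP(1)[OF t] by (rule plain.solution_imp_psd_block[OF P(1) t])
    show "psd (block_mat (ddt T Ph t + Ph t ** hA d t + transpose (hA d t) ** Ph t + meanQ P t)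
       (Ph t ** hB d t + meanS P t) (transpose (Ph t ** hB d t + meanS P t)) (meanR P t))"
      using mean.solution_imp_psd_block[OF Ph(1) t]
      unfolding lyap cross weight dP(2)[OF t] by (simp only: add.assoc)
    show "coercive (min e1 e2) (plain.weight t (P t))" "coercive (min e1 e2) (meanR P t)"
      using e t by (blast intro: coercive_mono min.cobounded1 min.cobounded2)+
  qed (use e P(2) Ph(2) psd_cone(3) in auto)
qed

end

theorem corollary4p11:
  fixes T :: real and d :: "('n::finite, 'm::finite) mflq"
  assumes "0 < T" and "mflq_data T d"
  shows "(\<exists>H K. relaxed_compensator T d H K) \<longleftrightarrow>
    (\<exists>P Ph. riccati_system T d P Ph \<and>
       (\<forall>P' Ph'. riccati_system T d P' Ph' \<longrightarrow> (\<forall>t\<in>{0..T}. P' t = P t \<and> Ph' t = Ph t)))"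
proof -
  interpret mflq_problem T d
    using assms by unfold_locales
  show ?thesis
  proof
    assume "\<exists>H K. relaxed_compensator T d H K"
    then obtain P Ph where "riccati_system T d P Ph"
      using compensator_imp_riccati by blast
    then show "\<exists>P Ph. riccati_system T d P Ph \<and>
       (\<forall>P' Ph'. riccati_system T d P' Ph' \<longrightarrow> (\<forall>t\<in>{0..T}. P' t = P t \<and> Ph' t = Ph t))"
      using riccati_system_unique by blast
  qed (use riccati_imp_compensator in blast)
qed

end
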